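(* Let $M(1)$ be the rank one Heisenberg vertex operator algebra. There are elements of $Q^\infty(M(1))$ that are not generated by elements of $O^\infty(M(1))$ and $J^\infty(M(1))$; that is, there exist elements of $Q^\infty(M(1))$ that do not lie in the two-sided ideal of $(U^\infty(M(1)),\diamond)$ generated by $O^\infty(M(1))\cup J^\infty(M(1))$.
   Context: All vector spaces are over $\mathbb{C}$; $\mathbb{N}=\{0,1,2,\dots\}$, $\mathbb{Z}_+=\{1,2,\dots\}$; $\binom{a}{m}=a(a-1)\cdots(a-m+1)/m!$ for $a\in\mathbb{Z}$, $m\in\mathbb{N}$. $\mathrm{Res}_x$ denotes the coefficient of $x^{-1}$, and powers of $(1+x)$ are expanded in nonnegative powers of $x$. **Grading-restricted vertex algebra.** A $\mathbb{Z}$-graded vector space $V=\coprod_{n\in\mathbb{Z}}V_{(n)}$ with a linear map $V\to(\mathrm{End}\,V)[[x,x^{-1}]]$, $v\mapsto Y(v,x)=\sum_{n\in\mathbb{Z}}v_nx^{-n-1}$, and a vector $\mathbf{1}\in V_{(0)}$ such that for all $a,b\in V$: (I) $\dim V_{(n)}<\infty$ for all $n$ and $V_{(n)}=0$ for $n$ sufficiently negative; (II) $a_nb=0$ for $n$ sufficiently large; (III) $Y(\mathbf{1},x)=1$; (IV) $Y(a,x)\mathbf{1}\in V[[x]]$ and $\lim_{x\to0}Y(a,x)\mathbf{1}=a$; (V) Jacobi identity: for all $l,m,n\in\mathbb{Z}$, $$\sum_{i\ge0}\binom{m}{i}(a_{l+i}b)_{m+n-i}=\sum_{i\ge0}(-1)^i\binom{l}{i}a_{m+l-i}b_{n+i}-\sum_{i\ge0}(-1)^{l+i}\binom{l}{i}b_{n+l-i}a_{m+i};$$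 (VI) with $L(0)v=nv$ for $v\in V_{(n)}$, $[L(0),Y(a,x)]=Y(L(0)a,x)+x\frac{d}{dx}Y(a,x)$; (VII) with $L(-1)v=\mathrm{Res}_xx^{-2}Y(v,x)\mathbf{1}$, $\frac{d}{dx}Y(a,x)=Y(L(-1)a,x)=[L(-1),Y(a,x)]$. If $v\in V_{(n)}$, $v$ is homogeneous with $\mathrm{wt}\,v=n$; then $x^{L(0)}v=x^{\mathrm{wt}\,v}v$ and $(1+x)^{L(0)}v=(1+x)^{\mathrm{wt}\,v}v$, extended linearly. Every vertex operator algebra is a grading-restricted vertex algebra. **Lower-bounded generalized $V$-module.** A $\mathbb{C}$-graded vector space $W=\coprod_{n\in\mathbb{C}}W_{(n)}$ with a linear map $V\to(\mathrm{End}\,W)[[x,x^{-1}]]$, $v\mapsto Y_W(v,x)=\sum_{n\in\mathbb{Z}}v_nx^{-n-1}$, such that: $W_{(n)}=0$ when $\mathrm{Re}\,n$ is sufficiently negative; for $a\in V,b\in W$, $a_nb=0$ for $n$ sufficiently large; $Y_W(\mathbf{1},x)=1$; the Jacobi identity (V) holds as an identity of operators on $W$ for $a,b\in V$; there is an operator $L_W(0)$ on $W$ with $[L_W(0),Y_W(a,x)]=Y_W(L(0)a,x)+x\frac{d}{dx}Y_W(a,x)$ and $W_{(n)}=\{w\in W\mid (L_W(0)-n)^kw=0\text{ for some }k\in\mathbb{Z}_+\}$; there is an operator $L_W(-1)$ on $W$ with $\frac{d}{dx}Y_W(u,x)=Y_W(L(-1)u,x)=[L_W(-1),Y_W(u,x)]$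 for $u\in V$. **$U^\infty(V)$ and $\diamond$.** $U^\infty(V)$ is the space of column-finite infinite matrices with entries in $V$, with rows and columns indexed by $\mathbb{N}$ (each column has only finitely many nonzero entries). For $v\in V$, $[v]_{kl}$ is the matrix with entry $v$ in position $(k,l)$ and $0$ elsewhere. The product $\diamond$ is given by $[u]_{km}\diamond[v]_{nl}=0$ if $m\neq n$ and $$[u]_{kn}\diamond[v]_{nl}=\sum_{m=0}^n\binom{-k+n-l-1}{m}\mathrm{Res}_x\,x^{-k+n-l-m-1}(1+x)^l\,[Y((1+x)^{L(0)}u,x)v]_{kl},$$ extended linearly: the $(k,l)$ component of $A\diamond B$ is $\sum_n[a_{kn}]_{kn}\diamond[b_{nl}]_{nl}$, a finite sum. A two-sided ideal is a subspace closed under left and right $\diamond$-multiplication by all of $U^\infty(V)$; the ideal generated by a set is the smallest one containing it. **$Q^\infty(V)$.** For a lower-bounded generalized $V$-module $W$ and $n\in\mathbb{N}$ let $\Omega_n(W)=\{w\in W\mid v_kw=0\text{ for all homogeneous }v\in V\text{ and }k\in\mathbb{Z}\text{ with }\mathrm{wt}\,v-k-1<-n\}$, $\Omega_{-1}(W)=0$, $\mathrm{Gr}_n(W)=\Omega_n(W)/\Omega_{n-1}(W)$, $\mathrm{Gr}(W)=\bigoplus_{n\in\mathbb{N}}\mathrm{Gr}_n(W)$, and for $w\in\Omega_n(W)$ let $[w]_n=w+\Omega_{n-1}(W)$. Define $\vartheta_{\mathrm{Gr}(W)}:U^\infty(V)\to\mathrm{End}\,\mathrm{Gr}(W)$ linearly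 by $\vartheta_{\mathrm{Gr}(W)}([v]_{kl})[w]_n=\delta_{ln}[\mathrm{Res}_x\,x^{l-k-1}Y_W(x^{L(0)}v,x)w]_k$. Then $Q^\infty(V)=\bigcap_W\ker\vartheta_{\mathrm{Gr}(W)}$ over all lower-bounded generalized $V$-modules $W$. **$O^\infty(V)$.** The subspace of $U^\infty(V)$ spanned by infinite linear combinations of elements $\mathrm{Res}_x\,x^{-k-l-p-2}(1+x)^l[Y((1+x)^{L(0)}u,x)v]_{kl}$ ($u,v\in V$, $k,l,p\in\mathbb{N}$) and $[(L(-1)+L(0)+l-k)v]_{kl}$ ($v\in V$, $k,l\in\mathbb{N}$), with each pair $(k,l)$ appearing only finitely many times. **$J^\infty(V)$.** The subspace of $U^\infty(V)$ spanned by the elements $$\sum_{\substack{j\in\mathbb{N}\\ n+p-j\ge0}}(-1)^j\binom{p}{j}[v]_{k,n+p-j}\diamond[u]_{n+p-j,l+p}-\sum_{\substack{j\in\mathbb{N}\\ l-n+k+p-j\ge0}}(-1)^{p-j}\binom{p}{j}[u]_{k,l-n+k+p-j}\diamond[v]_{l-n+k+p-j,l+p}-\sum_{j\in\mathbb{N}}\binom{\mathrm{wt}\,v+n-k-1}{j}[v_{p+j}u]_{k,l+p}$$ for $k\in\mathbb{N}$, $l,p,n\in\mathbb{Z}$ with $l+p\in\mathbb{N}$, and $u,v\in V$ with $v$ homogeneous. **Rank one Heisenberg VOA $M(1)$.** Let $\mathfrak{h}=\mathbb{C}\alpha$ be a one-dimensional (abelian) Lie algebra with bilinear form satisfying $(\alpha,\alpha)=1$;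 $\widehat{\mathfrak{h}}=\alpha\otimes\mathbb{C}[t,t^{-1}]\oplus\mathbb{C}c$ with $\alpha(m)=\alpha\otimes t^m$, $[\alpha(m),\alpha(n)]=m\delta_{m+n,0}c$, $[\alpha(m),c]=0$. As an $\widehat{\mathfrak{h}}$-module, $M(1)=U(\widehat{\mathfrak{h}})\otimes_{U(\mathfrak{h}\otimes\mathbb{C}[t]\oplus\mathbb{C}c)}\mathbb{C}\mathbf{1}$, where $\mathfrak{h}\otimes\mathbb{C}[t]$ acts trivially on $\mathbb{C}\mathbf{1}$ and $c$ acts as $1$. It carries its standard vertex operator algebra structure, with vacuum $\mathbf{1}$, $Y(\alpha(-1)\mathbf{1},x)=\sum_{n\in\mathbb{Z}}\alpha(n)x^{-n-1}$, conformal vector $\frac12\alpha(-1)^2\mathbf{1}$, and $\mathrm{wt}(\alpha(-i_1)\cdots\alpha(-i_j)\mathbf{1})=i_1+\cdots+i_j$. *)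

theory Defs
  imports Complex_Main "HOL-Library.Countable_Set" "HOL-Library.Function_Algebras"
    "HOL-Library.Poly_Mapping"
begin

section \<open>Complex vector spaces\<close>

class complex_vector = ab_group_add +
  fixes scaleC :: "complex \<Rightarrow> 'a \<Rightarrow> 'a" (infixr \<open>*\<^sub>C\<close> 75)
  assumes scaleC_add_right: "a *\<^sub>C (x + y) = a *\<^sub>C x + a *\<^sub>C y"
    and scaleC_add_left: "(a + b) *\<^sub>C x = a *\<^sub>C x + b *\<^sub>C x"
    and scaleC_scaleC: "a *\<^sub>C b *\<^sub>C x = (a * b) *\<^sub>C x"
    and scaleC_one: "1 *\<^sub>C x = x"

global_interpretation cv: vector_space "scaleC :: complex \<Rightarrow> 'a \<Rightarrow> 'a::complex_vector"
  by unfold_locales (rule scaleC_add_right scaleC_add_left scaleC_scaleC scaleC_one)+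

instantiation complex :: complex_vector
begin
definition scaleC_complex :: "complex \<Rightarrow> complex \<Rightarrow> complex" where
  "scaleC_complex a x = a * x"
instance by standard (simp_all add: scaleC_complex_def algebra_simps)
end

instantiation "fun" :: (type, complex_vector) complex_vector
begin
definition scaleC_fun :: "complex \<Rightarrow> ('a \<Rightarrow> 'b) \<Rightarrow> 'a \<Rightarrow> 'b" where
  "scaleC_fun a f = (\<lambda>x. a *\<^sub>C f x)"
instance
  by standard
    (simp_all add: scaleC_fun_def fun_eq_iff scaleC_add_right scaleC_add_left scaleC_scaleC scaleC_one)
end

instantiation poly_mapping :: (type, complex_vector) complex_vector
begin
lift_definition scaleC_poly_mapping :: "complex \<Rightarrow> ('a \<Rightarrow>\<^sub>0 'b) \<Rightarrow> 'a \<Rightarrow>\<^sub>0 'b"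
  is "\<lambda>a f x. a *\<^sub>C f x"
  by (rule finite_subset[rotated]) (auto simp: cv.scale_zero_right)
instance
  by (standard; transfer)
    (simp_all add: fun_eq_iff scaleC_add_right scaleC_add_left scaleC_scaleC scaleC_one)
end

definition linear_on :: "'a::complex_vector set \<Rightarrow> 'b::complex_vector set \<Rightarrow> ('a \<Rightarrow> 'b) \<Rightarrow> bool" where
  "linear_on S T f \<longleftrightarrow>
     (\<forall>x\<in>S. f x \<in> T) \<and>
     (\<forall>x\<in>S. \<forall>y\<in>S. f (x + y) = f x + f y) \<and>
     (\<forall>c. \<forall>x\<in>S. f (c *\<^sub>C x) = c *\<^sub>C f x)"

definition decomposes ::
  "('i \<Rightarrow> 'a::complex_vector set) \<Rightarrow> 'a \<Rightarrow> ('i \<Rightarrow> 'a) \<Rightarrow> bool" where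
  "decomposes G w f \<longleftrightarrow> finite {n. f n \<noteq> 0} \<and> (\<forall>n. f n \<in> G n) \<and> w = (\<Sum>n | f n \<noteq> 0. f n)"

definition graded_by :: "'a::complex_vector set \<Rightarrow> ('i \<Rightarrow> 'a set) \<Rightarrow> bool" where
  "graded_by W G \<longleftrightarrow>
     cv.subspace W \<and> (\<forall>n. cv.subspace (G n) \<and> G n \<subseteq> W) \<and> (\<forall>w\<in>W. \<exists>!f. decomposes G w f)"

definition component :: "('i \<Rightarrow> 'a::complex_vector set) \<Rightarrow> 'a \<Rightarrow> 'i \<Rightarrow> 'a" where
  "component G w = (THE f. decomposes G w f)"


section \<open>Grading-restricted vertex algebras\<close>

text \<open>
  \<open>modes V v n\<close> is the operator \<open>v\<^sub>n\<close>, that is, the coefficient of \<open>x\<close> to the power \<open>- n - 1\<close>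
  in \<open>Y(v,x)\<close>. All identities between formal series are written coefficientwise. The sums
  \<open>Sum_any\<close> have finite support whenever the lower truncation axiom holds.
\<close>

record 'v vertex_algebra_data =
  grading :: "int \<Rightarrow> 'v set"
  modes :: "'v \<Rightarrow> int \<Rightarrow> 'v \<Rightarrow> 'v"
  vacuum :: 'v

definition L0 :: "'v::complex_vector vertex_algebra_data \<Rightarrow> 'v \<Rightarrow> 'v" where
  "L0 V v = Sum_any (\<lambda>n. of_int n *\<^sub>C component (grading V) v n)"

definition Lm1 :: "'v vertex_algebra_data \<Rightarrow> 'v \<Rightarrow> 'v" where
  "Lm1 V v = modes V v (-2) (vacuum V)"

definition jacobi_identity ::
  "'v vertex_algebra_data \<Rightarrow> 'w::complex_vector set \<Rightarrow> ('v \<Rightarrow> int \<Rightarrow> 'w \<Rightarrow> 'w) \<Rightarrow> bool" where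
  "jacobi_identity V W Y \<longleftrightarrow> (\<forall>a b. \<forall>c\<in>W. \<forall>l m n :: int.
     Sum_any (\<lambda>i::nat. (of_int m gchoose i) *\<^sub>C Y (modes V a (l + int i) b) (m + n - int i) c) =
     Sum_any (\<lambda>i::nat. ((-1) ^ i * (of_int l gchoose i)) *\<^sub>C
                Y a (m + l - int i) (Y b (n + int i) c)) -
     Sum_any (\<lambda>i::nat. ((-1) powi (l + int i) * (of_int l gchoose i)) *\<^sub>C
                Y b (n + l - int i) (Y a (m + int i) c)))"

locale grading_restricted_vertex_algebra =
  fixes V :: "'v::complex_vector vertex_algebra_data"
  assumes graded: "graded_by UNIV (grading V)"
    and modes_linear_left: "linear_on UNIV UNIV (\<lambda>a. modes V a n b)"
    and modes_linear_right: "linear_on UNIV UNIV (modes V a n)"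
    and vacuum_grading: "vacuum V \<in> grading V 0"
    and finite_dimensional: "\<exists>B. finite B \<and> grading V n = cv.span B"
    and lower_bounded: "\<exists>N. \<forall>n<N. grading V n = {0}"
    and truncation: "\<exists>N. \<forall>n\<ge>N. modes V a n b = 0"
    and vacuum_left: "modes V (vacuum V) n b = (if n = -1 then b else 0)"
    and creation: "n \<ge> 0 \<Longrightarrow> modes V a n (vacuum V) = 0" "modes V a (-1) (vacuum V) = a"
    and jacobi: "jacobi_identity V UNIV (modes V)"
    and L0_bracket: "L0 V (modes V a n b) - modes V a n (L0 V b) =
                       modes V (L0 V a) n b + of_int (- n - 1) *\<^sub>C modes V a n b"
    and Lm1_derivative: "modes V (Lm1 V a) n b = of_int (- n) *\<^sub>C modes V a (n - 1) b"
    and Lm1_bracket: "Lm1 V (modes V a n b) - modes V a n (Lm1 V b) = modes V (Lm1 V a) n b"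


section \<open>Lower-bounded generalized modules\<close>

text \<open>
  The underlying vector space of a module is a subspace of the type \<open>'w\<close>; the operators are only
  relevant on this subspace.
\<close>

record ('v, 'w) module_data =
  mspace :: "'w set"
  mgrading :: "complex \<Rightarrow> 'w set"
  mmodes :: "'v \<Rightarrow> int \<Rightarrow> 'w \<Rightarrow> 'w"

locale lower_bounded_generalized_module = grading_restricted_vertex_algebra V
  for V :: "'v::complex_vector vertex_algebra_data" +
  fixes W :: "('v, 'w::complex_vector) module_data"
  assumes m_graded: "graded_by (mspace W) (mgrading W)"
    and mmodes_linear_left: "w \<in> mspace W \<Longrightarrow> linear_on UNIV (mspace W) (\<lambda>a. mmodes W a n w)"
    and mmodes_linear_right: "linear_on (mspace W) (mspace W) (mmodes W a n)"
    and m_lower_bounded: "\<exists>N::real. \<forall>n. Re n < N \<longrightarrow> mgrading W n = {0}"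
    and m_truncation: "w \<in> mspace W \<Longrightarrow> \<exists>N. \<forall>n\<ge>N. mmodes W a n w = 0"
    and m_vacuum: "w \<in> mspace W \<Longrightarrow> mmodes W (vacuum V) n w = (if n = -1 then w else 0)"
    and m_jacobi: "jacobi_identity V (mspace W) (mmodes W)"
    and m_L0: "\<exists>LW0. linear_on (mspace W) (mspace W) LW0 \<and>
          (\<forall>a n. \<forall>w\<in>mspace W. LW0 (mmodes W a n w) - mmodes W a n (LW0 w) =
              mmodes W (L0 V a) n w + of_int (- n - 1) *\<^sub>C mmodes W a n w) \<and>
          (\<forall>n. mgrading W n =
              {w \<in> mspace W. \<exists>k\<ge>1. ((\<lambda>y. LW0 y - n *\<^sub>C y) ^^ k) w = 0})"
    and m_Lm1: "\<exists>LW1. linear_on (mspace W) (mspace W) LW1 \<and>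
          (\<forall>a n. \<forall>w\<in>mspace W.
              mmodes W (Lm1 V a) n w = of_int (- n) *\<^sub>C mmodes W a (n - 1) w \<and>
              LW1 (mmodes W a n w) - mmodes W a n (LW1 w) = mmodes W (Lm1 V a) n w)"


section \<open>The algebra of column-finite matrices\<close>

type_synonym 'v matrix = "nat \<Rightarrow> nat \<Rightarrow> 'v"

definition U_inf :: "'v::zero matrix set" where
  "U_inf = {A. \<forall>l. finite {k. A k l \<noteq> 0}}"

definition elem_matrix :: "nat \<Rightarrow> nat \<Rightarrow> 'v::zero \<Rightarrow> 'v matrix" where
  "elem_matrix k l v = (\<lambda>i j. if i = k \<and> j = l then v else 0)"

text \<open>
  \<open>res V s l u v\<close> is the residue of \<open>x\<^sup>s (1 + x)\<^sup>l Y((1 + x)\<^bsup>L(0)\<^esup> u, x) v\<close>. For \<open>u\<close> homogeneous of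
  weight \<open>N\<close>, the coefficient of \<open>x\<^sup>i\<close> in \<open>(1 + x)\<^bsup>l + N\<^esup>\<close> meets the coefficient of
  \<open>x\<^bsup>- s - i - 1\<^esup>\<close> in \<open>Y(u,x) v\<close>, which is \<open>u\<^bsub>s + i\<^esub> v\<close>.
\<close>

definition res :: "'v::complex_vector vertex_algebra_data \<Rightarrow> int \<Rightarrow> int \<Rightarrow> 'v \<Rightarrow> 'v \<Rightarrow> 'v" where
  "res V s l u v = Sum_any (\<lambda>N::int. Sum_any (\<lambda>i::nat.
     (of_int (l + N) gchoose i) *\<^sub>C modes V (component (grading V) u N) (s + int i) v))"

text \<open>\<open>diamond_entry V k n l u v\<close> is the \<open>(k,l)\<close> entry of \<open>[u]\<^bsub>kn\<^esub> \<diamond> [v]\<^bsub>nl\<^esub>\<close>.\<close>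

definition diamond_entry ::
  "'v::complex_vector vertex_algebra_data \<Rightarrow> nat \<Rightarrow> nat \<Rightarrow> nat \<Rightarrow> 'v \<Rightarrow> 'v \<Rightarrow> 'v" where
  "diamond_entry V k n l u v = (\<Sum>m\<le>n.
     (of_int (- int k + int n - int l - 1) gchoose m) *\<^sub>C
       res V (- int k + int n - int l - int m - 1) (int l) u v)"

definition diamond ::
  "'v::complex_vector vertex_algebra_data \<Rightarrow> 'v matrix \<Rightarrow> 'v matrix \<Rightarrow> 'v matrix" where
  "diamond V A B = (\<lambda>k l. Sum_any (\<lambda>n. diamond_entry V k n l (A k n) (B n l)))"

definition two_sided_ideal :: "'v::complex_vector vertex_algebra_data \<Rightarrow> 'v matrix set \<Rightarrow> bool" where
  "two_sided_ideal V I \<longleftrightarrow> I \<subseteq> U_inf \<and> cv.subspace I \<and>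
     (\<forall>A\<in>U_inf. \<forall>B\<in>I. diamond V A B \<in> I \<and> diamond V B A \<in> I)"

definition generated_ideal ::
  "'v::complex_vector vertex_algebra_data \<Rightarrow> 'v matrix set \<Rightarrow> 'v matrix set" where
  "generated_ideal V S = \<Inter>{I. two_sided_ideal V I \<and> S \<subseteq> I}"


section \<open>The ideal annihilating all associated graded spaces\<close>

definition Omega :: "'v vertex_algebra_data \<Rightarrow> ('v, 'w::zero) module_data \<Rightarrow> int \<Rightarrow> 'w set" where
  "Omega V W n = (if n < 0 then {0} else
     {w \<in> mspace W. \<forall>N v k. v \<in> grading V N \<longrightarrow> N - k - 1 < - n \<longrightarrow> mmodes W v k w = 0})"

definition Gr_class ::
  "'v vertex_algebra_data \<Rightarrow> ('v, 'w::complex_vector) module_data \<Rightarrow> nat \<Rightarrow> 'w \<Rightarrow> 'w set" where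
  "Gr_class V W n w = {w + y | y. y \<in> Omega V W (int n - 1)}"

text \<open>
  An element of \<open>Gr(W)\<close> is the family of its components in the quotients
  \<open>\<Omega>\<^sub>n(W) / \<Omega>\<^bsub>n - 1\<^esub>(W)\<close>, which are sets of cosets; its zero is \<open>\<lambda>n. Gr_class V W n 0\<close>.
\<close>

definition Gr ::
  "'v vertex_algebra_data \<Rightarrow> ('v, 'w::complex_vector) module_data \<Rightarrow> (nat \<Rightarrow> 'w set) set" where
  "Gr V W = {g. (\<forall>n. g n \<in> Gr_class V W n ` Omega V W (int n)) \<and>
                finite {n. g n \<noteq> Gr_class V W n 0}}"

text \<open>
  \<open>mode_kl V W k l v w\<close> is the residue of \<open>x\<^bsup>l - k - 1\<^esup> Y\<^sub>W(x\<^bsup>L(0)\<^esup> v, x) w\<close>.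
\<close>

definition mode_kl :: "'v::complex_vector vertex_algebra_data \<Rightarrow>
    ('v, 'w::complex_vector) module_data \<Rightarrow> nat \<Rightarrow> nat \<Rightarrow> 'v \<Rightarrow> 'w \<Rightarrow> 'w" where
  "mode_kl V W k l v w =
     Sum_any (\<lambda>N::int. mmodes W (component (grading V) v N) (N + int l - int k - 1) w)"

text \<open>
  The operators \<open>mode_kl V W k l v\<close> map \<open>\<Omega>\<^sub>l(W)\<close> to \<open>\<Omega>\<^sub>k(W)\<close> and \<open>\<Omega>\<^bsub>l - 1\<^esub>(W)\<close> to
  \<open>\<Omega>\<^bsub>k - 1\<^esub>(W)\<close>, so the choice of representatives below is immaterial (see \<open>mode_kl_Omega\<close> and
  \<open>theta_single_class\<close>).
\<close>

definition theta :: "'v::complex_vector vertex_algebra_data \<Rightarrow>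
    ('v, 'w::complex_vector) module_data \<Rightarrow> 'v matrix \<Rightarrow> (nat \<Rightarrow> 'w set) \<Rightarrow> nat \<Rightarrow> 'w set" where
  "theta V W A g = (\<lambda>k. Gr_class V W k
     (\<Sum>l | g l \<noteq> Gr_class V W l 0. mode_kl V W k l (A k l) (SOME w. w \<in> g l)))"

definition theta_kernel :: "'v::complex_vector vertex_algebra_data \<Rightarrow>
    ('v, 'w::complex_vector) module_data \<Rightarrow> 'v matrix set" where
  "theta_kernel V W = {A \<in> U_inf. \<forall>g\<in>Gr V W. theta V W A g = (\<lambda>k. Gr_class V W k 0)}"

text \<open>
  HOL cannot quantify over all types, so the modules range over those whose underlying space is a
  subspace of \<open>nat \<Rightarrow> complex\<close>. By \<open>Q_inf_subset_theta_kernel\<close> below this is no restriction.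
\<close>

definition Q_inf :: "'v::complex_vector vertex_algebra_data \<Rightarrow> 'v matrix set" where
  "Q_inf V = \<Inter>{theta_kernel V W | W :: ('v, nat \<Rightarrow> complex) module_data.
                  lower_bounded_generalized_module V W}"


section \<open>Independence of the universe of modules\<close>

text \<open>
  Theorem \<open>Q_inf_subset_theta_kernel\<close> at the end of this section shows that the elements of
  \<open>Q_inf V\<close> act as 0 on \<open>Gr(W)\<close> for every module \<open>W\<close> over an arbitrary type: a vector of \<open>W\<close> lies in
  a submodule of countable dimension, which embeds into \<open>nat \<Rightarrow> complex\<close>.
\<close>

lemma linear_onD:
  assumes "linear_on S T f"
  shows "x \<in> S \<Longrightarrow> f x \<in> T"
    and "x \<in> S \<Longrightarrow> y \<in> S \<Longrightarrow> f (x + y) = f x + f y"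
    and "x \<in> S \<Longrightarrow> f (c *\<^sub>C x) = c *\<^sub>C f x"
  using assms by (auto simp: linear_on_def)

lemma linear_on_0:
  assumes "linear_on S T f" "cv.subspace S"
  shows "f 0 = 0"
  using linear_onD(3)[OF assms(1) cv.subspace_0[OF assms(2)], of 0] by simp

lemma linear_on_sum:
  assumes "linear_on S T f" "cv.subspace S" "\<And>i. i \<in> I \<Longrightarrow> g i \<in> S"
  shows "f (sum g I) = (\<Sum>i\<in>I. f (g i))"
  using assms(3)
proof (induction I rule: infinite_finite_induct)
  case (insert i I)
  then have "sum g I \<in> S"
    by (intro cv.subspace_sum[OF assms(2)]) auto
  with insert show ?case
    by (simp add: linear_onD(2)[OF assms(1)])
qed (simp_all add: linear_on_0[OF assms(1,2)])

lemma subspace_Sum_any: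
  assumes "cv.subspace S" "\<And>i. g i \<in> S"
  shows "Sum_any g \<in> S"
  unfolding Sum_any.expand_set by (intro cv.subspace_sum[OF assms(1)]) (rule assms(2))

lemma linear_on_Sum_any_inj:
  assumes "linear_on S T f" "cv.subspace S" "inj_on f S" "\<And>i. g i \<in> S"
  shows "f (Sum_any g) = Sum_any (\<lambda>i. f (g i))"
proof -
  have "f x = 0 \<longleftrightarrow> x = 0" if "x \<in> S" for x
    using linear_on_0[OF assms(1,2)] inj_onD[OF assms(3), of x 0] cv.subspace_0[OF assms(2)] that
    by auto
  then have "{i. f (g i) \<noteq> 0} = {i. g i \<noteq> 0}"
    using assms(4) by auto
  then show ?thesis
    unfolding Sum_any.expand_set
    by (simp add: linear_on_sum[OF assms(1,2)] assms(4))
qed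

lemma decomposes_component: "graded_by W G \<Longrightarrow> w \<in> W \<Longrightarrow> decomposes G w (component G w)"
  unfolding graded_by_def component_def by (rule theI'[of "decomposes G w"]) simp

lemma component_eqI: "graded_by W G \<Longrightarrow> w \<in> W \<Longrightarrow> decomposes G w f \<Longrightarrow> component G w = f"
  unfolding graded_by_def component_def by (rule the1_equality[of "decomposes G w"]) simp_all

lemma component_homogeneous:
  assumes "graded_by W G" "w \<in> G n"
  shows "component G w = (\<lambda>m. if m = n then w else 0)"
proof (rule component_eqI[OF assms(1)])
  show "w \<in> W"
    using assms by (auto simp: graded_by_def)
  have eq: "{m. (if m = n then w else 0) \<noteq> 0} = (if w = 0 then {} else {n})"
    by auto
  show "decomposes G w (\<lambda>m. if m = n then w else 0)"
    unfolding decomposes_def eq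
    using assms by (auto simp: graded_by_def cv.subspace_0)
qed

lemma component_mem: "graded_by W G \<Longrightarrow> w \<in> W \<Longrightarrow> component G w n \<in> G n"
  using decomposes_component by (fastforce simp: decomposes_def)

context grading_restricted_vertex_algebra
begin

lemma L0_homogeneous: "v \<in> grading V n \<Longrightarrow> L0 V v = of_int n *\<^sub>C v"
proof -
  assume "v \<in> grading V n"
  then have "L0 V v = Sum_any (\<lambda>m. if m = n then of_int m *\<^sub>C v else 0)"
    unfolding L0_def component_homogeneous[OF graded \<open>v \<in> grading V n\<close>]
    by (intro arg_cong[of _ _ Sum_any]) (auto simp: fun_eq_iff)
  then show ?thesis
    by simp
qed

lemma subspace_grading: "cv.subspace (grading V n)"
  using graded by (auto simp: graded_by_def)

lemma L0_eigenvector: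
  assumes "L0 V x = of_int n *\<^sub>C x"
  shows "x \<in> grading V n"
proof -
  let ?f = "component (grading V) x"
  have f: "finite {m. ?f m \<noteq> 0}" "\<And>m. ?f m \<in> grading V m" "x = (\<Sum>m | ?f m \<noteq> 0. ?f m)"
    using decomposes_component[OF graded, of x] by (auto simp: decomposes_def)
  have "decomposes (grading V) (L0 V x) (\<lambda>m. of_int m *\<^sub>C ?f m)"
    unfolding decomposes_def L0_def Sum_any.expand_set
    using f by (auto intro: rev_finite_subset cv.subspace_scale[OF subspace_grading])
  moreover have "decomposes (grading V) (L0 V x) (\<lambda>m. of_int n *\<^sub>C ?f m)"
    unfolding decomposes_def
  proof (intro conjI allI)
    show "finite {m. of_int n *\<^sub>C ?f m \<noteq> 0}"
      by (rule finite_subset[OF _ f(1)]) auto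
    show "of_int n *\<^sub>C ?f m \<in> grading V m" for m
      using f by (auto intro: cv.subspace_scale[OF subspace_grading])
    have "of_int n *\<^sub>C x = (\<Sum>m | ?f m \<noteq> 0. of_int n *\<^sub>C ?f m)"
      by (subst f(3)) (rule cv.scale_sum_right)
    also have "\<dots> = (\<Sum>m | of_int n *\<^sub>C ?f m \<noteq> 0. of_int n *\<^sub>C ?f m)"
      by (rule sum.mono_neutral_right) (use f in auto)
    finally show "L0 V x = \<dots>"
      by (simp add: assms)
  qed
  ultimately have "(\<lambda>m. of_int m *\<^sub>C ?f m) = (\<lambda>m. of_int n *\<^sub>C ?f m)"
    using component_eqI[OF graded] by (metis UNIV_I)
  then have "of_int m *\<^sub>C ?f m = of_int n *\<^sub>C ?f m" for m
    by (rule fun_cong)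
  then have "?f m = 0" if "m \<noteq> n" for m
    using that by (metis cv.scale_right_imp_eq of_int_eq_iff)
  then have "(\<Sum>m | ?f m \<noteq> 0. ?f m) = (\<Sum>m\<in>{n}. ?f m)"
    by (intro sum.mono_neutral_left) auto
  then show ?thesis
    using f(2)[of n] f(3) by simp
qed

lemma modes_grading:
  assumes "u \<in> grading V M" "v \<in> grading V N"
  shows "modes V u i v \<in> grading V (M + N - i - 1)"
proof (rule L0_eigenvector)
  have "L0 V (modes V u i v) =
      modes V u i (L0 V v) + (modes V (L0 V u) i v + of_int (- i - 1) *\<^sub>C modes V u i v)"
    using L0_bracket[of u i v] by (metis add.commute diff_eq_eq)
  also have "\<dots> = of_int N *\<^sub>C modes V u i v +
      (of_int M *\<^sub>C modes V u i v + of_int (- i - 1) *\<^sub>C modes V u i v)"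
    by (simp only: L0_homogeneous[OF assms(1)] L0_homogeneous[OF assms(2)] UNIV_I
        linear_onD(3)[OF modes_linear_left] linear_onD(3)[OF modes_linear_right])
  also have "\<dots> = (of_int N + (of_int M + of_int (- i - 1))) *\<^sub>C modes V u i v"
    by (simp only: cv.scale_left_distrib)
  also have "of_int N + (of_int M + of_int (- i - 1)) = (of_int (M + N - i - 1) :: complex)"
    by simp
  finally show "L0 V (modes V u i v) = of_int (M + N - i - 1) *\<^sub>C modes V u i v" .
qed

end

context lower_bounded_generalized_module
begin

lemma subspace_mspace: "cv.subspace (mspace W)"
  using m_graded by (auto simp: graded_by_def)

lemma mmodes_mem: "w \<in> mspace W \<Longrightarrow> mmodes W a n w \<in> mspace W"
  using linear_onD(1)[OF mmodes_linear_right] .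

lemma mmodes_0: "mmodes W a n 0 = 0"
  using linear_on_0[OF mmodes_linear_right subspace_mspace] .

lemma subspace_Omega: "cv.subspace (Omega V W n)"
proof (cases "n < 0")
  case False
  then show ?thesis
    using cv.subspace_0[OF subspace_mspace] cv.subspace_add[OF subspace_mspace]
      cv.subspace_scale[OF subspace_mspace]
    by (auto intro!: cv.subspaceI simp: Omega_def mmodes_0 linear_onD(2,3)[OF mmodes_linear_right])
qed (simp add: Omega_def)

lemma Omega_mspace: "w \<in> Omega V W n \<Longrightarrow> w \<in> mspace W"
  using cv.subspace_0[OF subspace_mspace] by (auto simp: Omega_def split: if_splits)

lemma mmodes_Omega:
  assumes w: "w \<in> Omega V W l" and v: "v \<in> grading V N" and shift: "N - j - 1 = k - l"
  shows "mmodes W v j w \<in> Omega V W k"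
proof -
  have wW: "w \<in> mspace W"
    using w by (rule Omega_mspace)
  show ?thesis
  proof (cases "l < 0 \<or> k < 0")
    case True
    then have "mmodes W v j w = 0"
    proof (cases "l < 0")
      case True
      then show ?thesis using w by (simp add: Omega_def mmodes_0)
    next
      case False
      then have "N - j - 1 < - l" using True shift by simp
      then show ?thesis using w v False by (auto simp: Omega_def)
    qed
    then show ?thesis
      using cv.subspace_0[OF subspace_Omega] by simp
  next
    case False
    then have l: "\<And>N v k. v \<in> grading V N \<Longrightarrow> N - k - 1 < - l \<Longrightarrow> mmodes W v k w = 0"
      using w by (auto simp: Omega_def)
    have "mmodes W u m (mmodes W v j w) = 0"
      if u: "u \<in> grading V M" and m: "M - m - 1 < - k" for u M m
    proof -
      define f where "f r = mmodes W u (m + j - r) (mmodes W v r w)" for r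
      obtain R where R: "\<And>r. r \<ge> R \<Longrightarrow> mmodes W v r w = 0"
        using m_truncation[OF wW] by blast
      obtain q where q: "\<And>r. r \<ge> q \<Longrightarrow> mmodes W u r w = 0"
        using m_truncation[OF wW] by blast
      have "f r = 0" for r
      proof (induction "nat (R - r)" arbitrary: r rule: less_induct)
        case less
        show ?case
        proof (cases "r \<ge> R")
          case True
          then show ?thesis by (simp add: f_def R mmodes_0)
        next
          case False
          define L where "L = m + j - q - r"
          have IH: "f (r + int i) = 0" if "i \<noteq> 0" for i
            using less[of "r + int i"] that False by simp
          have "Sum_any (\<lambda>i::nat. (of_int q gchoose i) *\<^sub>C
                  mmodes W (modes V u (L + int i) v) (q + r - int i) w) =
              Sum_any (\<lambda>i::nat. ((-1) ^ i * (of_int L gchoose i)) *\<^sub>C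
                  mmodes W u (q + L - int i) (mmodes W v (r + int i) w)) -
              Sum_any (\<lambda>i::nat. ((-1) powi (L + int i) * (of_int L gchoose i)) *\<^sub>C
                  mmodes W v (r + L - int i) (mmodes W u (q + int i) w))"
            using m_jacobi wW unfolding jacobi_identity_def by blast
          moreover have "mmodes W (modes V u (L + int i) v) (q + r - int i) w = 0" for i
            by (rule l[OF modes_grading[OF u v]]) (use m shift in \<open>simp add: L_def\<close>)
          moreover have "mmodes W u (q + L - int i) (mmodes W v (r + int i) w) = f (r + int i)" for i
            by (simp add: f_def L_def algebra_simps)
          ultimately have "Sum_any (\<lambda>i::nat. ((-1) ^ i * (of_int L gchoose i)) *\<^sub>C f (r + int i)) = 0"
            by (simp add: q mmodes_0)
          also have "Sum_any (\<lambda>i::nat. ((-1) ^ i * (of_int L gchoose i)) *\<^sub>C f (r + int i)) =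
              (\<Sum>i\<in>{0}. ((-1) ^ i * (of_int L gchoose i)) *\<^sub>C f (r + int i))"
            by (rule Sum_any.expand_superset) (use IH in auto)
          finally show ?thesis by simp
        qed
      qed
      from this[of j] show ?thesis by (simp add: f_def)
    qed
    then show ?thesis
      using False mmodes_mem[OF wW] by (auto simp: Omega_def)
  qed
qed

lemma mode_kl_eq:
  assumes "w \<in> mspace W"
  shows "mode_kl V W k l v w = (\<Sum>N | component (grading V) v N \<noteq> 0.
           mmodes W (component (grading V) v N) (N + int l - int k - 1) w)"
  unfolding mode_kl_def
proof (rule Sum_any.expand_superset)
  show "finite {N. component (grading V) v N \<noteq> 0}"
    using decomposes_component[OF graded, of v] by (simp add: decomposes_def)
  have "mmodes W 0 n w = 0" for n
    using linear_on_0[OF mmodes_linear_left[OF assms]] cv.subspace_UNIV by blast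
  then show "{N. mmodes W (component (grading V) v N) (N + int l - int k - 1) w \<noteq> 0}
      \<subseteq> {N. component (grading V) v N \<noteq> 0}"
    by auto
qed

lemma mode_kl_add:
  assumes "w \<in> mspace W" "y \<in> mspace W"
  shows "mode_kl V W k l v (w + y) = mode_kl V W k l v w + mode_kl V W k l v y"
  using assms
  by (simp add: mode_kl_eq cv.subspace_add[OF subspace_mspace] linear_onD(2)[OF mmodes_linear_right]
      sum.distrib)

lemma mode_kl_Omega:
  assumes "w \<in> Omega V W (int l - i)"
  shows "mode_kl V W k l v w \<in> Omega V W (int k - i)"
  unfolding mode_kl_def
  by (intro subspace_Sum_any[OF subspace_Omega] mmodes_Omega[OF assms component_mem[OF graded]]) auto

lemma Gr_class_eq_iff:
  "Gr_class V W n w = Gr_class V W n w' \<longleftrightarrow> w - w' \<in> Omega V W (int n - 1)"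
proof
  assume "Gr_class V W n w = Gr_class V W n w'"
  moreover have "w \<in> Gr_class V W n w"
    using cv.subspace_0[OF subspace_Omega] by (force simp: Gr_class_def)
  ultimately show "w - w' \<in> Omega V W (int n - 1)"
    by (auto simp: Gr_class_def)
next
  have sub: "Gr_class V W n w \<subseteq> Gr_class V W n w'" if "w - w' \<in> Omega V W (int n - 1)" for w w'
  proof
    fix x
    assume "x \<in> Gr_class V W n w"
    then obtain y where "x = w + y" "y \<in> Omega V W (int n - 1)"
      by (auto simp: Gr_class_def)
    then have "x = w' + ((w - w') + y)" "(w - w') + y \<in> Omega V W (int n - 1)"
      using cv.subspace_add[OF subspace_Omega] that by auto
    then show "x \<in> Gr_class V W n w'"
      unfolding Gr_class_def by blast
  qed
  assume *: "w - w' \<in> Omega V W (int n - 1)"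
  then have "w' - w \<in> Omega V W (int n - 1)"
    using cv.subspace_neg[OF subspace_Omega] by fastforce
  with * sub show "Gr_class V W n w = Gr_class V W n w'"
    by blast
qed

lemma Omega_mono: "w \<in> Omega V W (int l - 1) \<Longrightarrow> w \<in> Omega V W (int l)"
  using cv.subspace_0[OF subspace_Omega, of "int l"] by (auto simp: Omega_def split: if_splits)

lemma Gr_class_representative:
  assumes "w \<in> Omega V W (int l)"
  shows "(SOME x. x \<in> Gr_class V W l w) \<in> Omega V W (int l)"
    and "(SOME x. x \<in> Gr_class V W l w) - w \<in> Omega V W (int l - 1)"
proof -
  have "w \<in> Gr_class V W l w"
    using cv.subspace_0[OF subspace_Omega] by (force simp: Gr_class_def)
  then have "(SOME x. x \<in> Gr_class V W l w) \<in> Gr_class V W l w"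
    by (rule someI)
  then show "(SOME x. x \<in> Gr_class V W l w) - w \<in> Omega V W (int l - 1)"
    by (auto simp: Gr_class_def)
  then have "w + ((SOME x. x \<in> Gr_class V W l w) - w) \<in> Omega V W (int l)"
    using assms Omega_mono cv.subspace_add[OF subspace_Omega] by blast
  then show "(SOME x. x \<in> Gr_class V W l w) \<in> Omega V W (int l)"
    by simp
qed

lemma theta_single_class:
  assumes "w \<in> Omega V W (int l)"
  shows "theta V W A (\<lambda>n. Gr_class V W n (if n = l then w else 0)) k =
           Gr_class V W k (mode_kl V W k l (A k l) w)"
proof -
  let ?r = "SOME x. x \<in> Gr_class V W l w"
  have rep: "?r \<in> Omega V W (int l)" "?r - w \<in> Omega V W (int l - 1)"
    using Gr_class_representative[OF assms] .
  have supp: "{n. Gr_class V W n (if n = l then w else 0) \<noteq> Gr_class V W n 0} =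
      (if w \<in> Omega V W (int l - 1) then {} else {l})"
    by (auto simp: Gr_class_eq_iff cv.subspace_0[OF subspace_Omega])
  have "mode_kl V W k l v ?r - mode_kl V W k l v w \<in> Omega V W (int k - 1)" for v
  proof -
    have "mode_kl V W k l v (w + (?r - w)) = mode_kl V W k l v w + mode_kl V W k l v (?r - w)"
      using assms rep Omega_mspace by (intro mode_kl_add) auto
    then show ?thesis
      using mode_kl_Omega[OF rep(2)] by simp
  qed
  then show ?thesis
    unfolding theta_def supp using mode_kl_Omega[of w l 1 k "A k l"]
    by (auto simp: Gr_class_eq_iff intro: cv.subspace_neg[OF subspace_Omega])
qed

lemma theta_kernel_iff:
  "A \<in> theta_kernel V W \<longleftrightarrow> A \<in> U_inf \<and>
     (\<forall>k l. \<forall>w\<in>Omega V W (int l). mode_kl V W k l (A k l) w \<in> Omega V W (int k - 1))"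
proof (intro iffI conjI allI ballI)
  fix k l w
  assume A: "A \<in> theta_kernel V W" and w: "w \<in> Omega V W (int l)"
  let ?g = "\<lambda>n. Gr_class V W n (if n = l then w else 0)"
  have "?g \<in> Gr V W"
    unfolding Gr_def using w
    by (auto intro!: imageI cv.subspace_0[OF subspace_Omega] intro: finite_subset[of _ "{l}"])
  with A have "theta V W A ?g = (\<lambda>k. Gr_class V W k 0)"
    by (auto simp: theta_kernel_def)
  then have "theta V W A ?g k = Gr_class V W k 0"
    by (rule fun_cong)
  then have "Gr_class V W k (mode_kl V W k l (A k l) w) = Gr_class V W k 0"
    unfolding theta_single_class[OF w] .
  then show "mode_kl V W k l (A k l) w \<in> Omega V W (int k - 1)"
    by (simp add: Gr_class_eq_iff)
next
  assume *: "A \<in> U_inf \<and>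
     (\<forall>k l. \<forall>w\<in>Omega V W (int l). mode_kl V W k l (A k l) w \<in> Omega V W (int k - 1))"
  have "theta V W A g = (\<lambda>k. Gr_class V W k 0)" if "g \<in> Gr V W" for g
  proof
    fix k
    have "(SOME x. x \<in> g l) \<in> Omega V W (int l)" for l
    proof -
      obtain w where "w \<in> Omega V W (int l)" "g l = Gr_class V W l w"
        using \<open>g \<in> Gr V W\<close> unfolding Gr_def by blast
      then show ?thesis
        using Gr_class_representative(1) by simp
    qed
    with * show "theta V W A g k = Gr_class V W k 0"
      by (auto simp: theta_def Gr_class_eq_iff intro!: cv.subspace_sum[OF subspace_Omega])
  qed
  with * show "A \<in> theta_kernel V W"
    by (auto simp: theta_kernel_def)
qed (auto simp: theta_kernel_def)

end

lemma decomposes_Sum_any: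
  "decomposes G w f \<longleftrightarrow> finite {n. f n \<noteq> 0} \<and> (\<forall>n. f n \<in> G n) \<and> w = Sum_any f"
  by (simp add: decomposes_def Sum_any.expand_set)

lemma linear_on_component:
  assumes "graded_by W G"
  shows "linear_on W W (\<lambda>x. component G x n)"
proof -
  have W: "cv.subspace W" and G: "\<And>n. cv.subspace (G n)" "\<And>n. G n \<subseteq> W"
    using assms by (auto simp: graded_by_def)
  have add: "component G (x + y) = (\<lambda>n. component G x n + component G y n)"
    if "x \<in> W" "y \<in> W" for x y
  proof (rule component_eqI[OF assms cv.subspace_add[OF W that]])
    have *: "decomposes G x (component G x)" "decomposes G y (component G y)"
      using that by (auto intro: decomposes_component[OF assms])
    have fin: "finite ({n. component G x n \<noteq> 0} \<union> {n. component G y n \<noteq> 0})"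
      using * by (simp add: decomposes_def)
    then have "finite {n. component G x n + component G y n \<noteq> 0}"
      by (rule rev_finite_subset) auto
    then show "decomposes G (x + y) (\<lambda>n. component G x n + component G y n)"
      using * unfolding decomposes_Sum_any
      by (auto intro: cv.subspace_add[OF G(1)] simp: Sum_any.distrib)
  qed
  have scale: "component G (c *\<^sub>C x) = (\<lambda>n. c *\<^sub>C component G x n)" if "x \<in> W" for c x
  proof (rule component_eqI[OF assms cv.subspace_scale[OF W that]])
    have *: "decomposes G x (component G x)"
      using that by (auto intro: decomposes_component[OF assms])
    then have sub: "finite {n. component G x n \<noteq> 0}"
      by (simp add: decomposes_def)
    have "c *\<^sub>C x = (\<Sum>n | component G x n \<noteq> 0. c *\<^sub>C component G x n)"
      using * by (metis (no_types) cv.scale_sum_right decomposes_def)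
    also have "\<dots> = Sum_any (\<lambda>n. c *\<^sub>C component G x n)"
      by (rule Sum_any.expand_superset[symmetric, OF sub]) auto
    finally have "c *\<^sub>C x = Sum_any (\<lambda>n. c *\<^sub>C component G x n)" .
    moreover have "finite {n. c *\<^sub>C component G x n \<noteq> 0}"
      by (rule finite_subset[OF _ sub]) auto
    ultimately show "decomposes G (c *\<^sub>C x) (\<lambda>n. c *\<^sub>C component G x n)"
      using * unfolding decomposes_Sum_any by (auto intro: cv.subspace_scale[OF G(1)])
  qed
  show ?thesis
    unfolding linear_on_def using component_mem[OF assms] G(2) add scale by fastforce
qed

lemma linear_on_span_closed:
  assumes "linear_on W W f" "cv.subspace W" "S \<subseteq> W" "\<And>x. x \<in> S \<Longrightarrow> f x \<in> cv.span S"
    and "x \<in> cv.span S"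
  shows "f x \<in> cv.span S"
proof -
  have sub: "cv.span S \<subseteq> W"
    using assms(3,2) by (rule cv.span_minimal)
  have "cv.subspace {x \<in> cv.span S. f x \<in> cv.span S}"
    using sub by (auto intro!: cv.subspaceI
        simp: linear_on_0[OF assms(1,2)] linear_onD(2,3)[OF assms(1)] subset_iff
          cv.span_zero cv.span_add cv.span_scale)
  moreover have "S \<subseteq> {x \<in> cv.span S. f x \<in> cv.span S}"
    using assms(4) cv.span_base by blast
  ultimately have "cv.span S \<subseteq> {x \<in> cv.span S. f x \<in> cv.span S}"
    by (meson cv.span_minimal)
  with assms(5) show ?thesis
    by blast
qed

lemma countable_embedding:
  assumes "countable S"
  obtains \<phi> :: "'a::complex_vector \<Rightarrow> nat \<Rightarrow> complex"
  where "linear_on (cv.span S) UNIV \<phi>" "inj_on \<phi> (cv.span S)"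
proof -
  obtain B where B: "B \<subseteq> S" "cv.independent B" "S \<subseteq> cv.span B"
    using cv.maximal_independent_subset[of S] by blast
  have cB: "countable B"
    using B(1) assms countable_subset by blast
  have span: "cv.span S = cv.span B"
    using B by (meson cv.span_eq cv.span_superset subset_trans)
  let ?r = "cv.representation B"
  define \<phi> :: "'a \<Rightarrow> nat \<Rightarrow> complex" where "\<phi> x = (\<lambda>i. ?r x (from_nat_into B i))" for x
  have "linear_on (cv.span B) UNIV \<phi>"
    by (auto simp: linear_on_def \<phi>_def fun_eq_iff scaleC_fun_def scaleC_complex_def
        cv.representation_add[OF B(2)] cv.representation_scale[OF B(2)])
  moreover have "inj_on \<phi> (cv.span B)"
  proof (rule inj_onI)
    fix x y
    assume xy: "x \<in> cv.span B" "y \<in> cv.span B" "\<phi> x = \<phi> y"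
    have "?r x b = ?r y b" for b
    proof (cases "b \<in> B")
      case True
      then have "from_nat_into B (to_nat_on B b) = b"
        by (simp add: cB)
      then show ?thesis
        using fun_cong[OF xy(3), of "to_nat_on B b"] by (simp add: \<phi>_def)
    next
      case False
      then show ?thesis
        by (metis cv.representation_ne_zero)
    qed
    then have "?r x = ?r y"
      by blast
    then show "x = y"
      using cv.sum_nonzero_representation_eq[OF B(2)] xy by metis
  qed
  ultimately show ?thesis
    using that unfolding span by blast
qed

context grading_restricted_vertex_algebra
begin

lemma countable_spanning: "\<exists>B. countable B \<and> cv.span B = (UNIV :: 'v set)"
proof -
  obtain b where b: "\<And>n. finite (b n)" "\<And>n. grading V n = cv.span (b n)"
    using finite_dimensional by metis
  define B where "B = (\<Union>n. b n)"
  have "x \<in> cv.span B" for x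
  proof -
    have "component (grading V) x n \<in> cv.span B" for n
    proof -
      have "component (grading V) x n \<in> cv.span (b n)"
        using component_mem[OF graded, of x n] b(2) by simp
      then show ?thesis
        using cv.span_mono[of "b n" B] by (auto simp: B_def)
    qed
    then have "(\<Sum>n | component (grading V) x n \<noteq> 0. component (grading V) x n)
        \<in> cv.span B"
      by (intro cv.span_sum)
    then show ?thesis
      using decomposes_component[OF graded, of x] by (simp add: decomposes_def)
  qed
  moreover have "countable B"
    using b(1) by (auto simp: B_def intro: countable_finite)
  ultimately show ?thesis
    by (intro exI[of _ B]) (simp add: set_eq_iff)
qed

end

context lower_bounded_generalized_module
begin

lemma countable_submodule:
  assumes w: "w \<in> mspace W"
    and L: "linear_on (mspace W) (mspace W) LW0" "linear_on (mspace W) (mspace W) LW1"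
  obtains S where "countable S" "w \<in> S" "S \<subseteq> mspace W"
    and "\<And>a n x. x \<in> cv.span S \<Longrightarrow> mmodes W a n x \<in> cv.span S"
    and "\<And>n x. x \<in> cv.span S \<Longrightarrow> component (mgrading W) x n \<in> cv.span S"
    and "\<And>x. x \<in> cv.span S \<Longrightarrow> LW0 x \<in> cv.span S"
    and "\<And>x. x \<in> cv.span S \<Longrightarrow> LW1 x \<in> cv.span S"
proof -
  obtain B where B: "countable B" "cv.span B = (UNIV :: 'v set)"
    using countable_spanning by blast
  define F where "F = {LW0, LW1} \<union> (\<lambda>(b, n). mmodes W b n) ` (B \<times> UNIV)"
  have cF: "countable F"
    unfolding F_def using B(1) by auto
  have F: "linear_on (mspace W) (mspace W) f" if "f \<in> F" for f
    using that L mmodes_linear_right by (auto simp: F_def)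
  define step where
    "step X = X \<union> (\<Union>f\<in>F. f ` X) \<union> (\<Union>x\<in>X. range (component (mgrading W) x))" for X
  define S where "S = (\<Union>i. (step ^^ i) {w})"
  have T: "(step ^^ i) {w} \<subseteq> mspace W \<and> countable ((step ^^ i) {w})" for i
  proof (induction i)
    case (Suc i)
    have "countable (range (component (mgrading W) x))" if "x \<in> mspace W" for x
    proof (rule countable_subset)
      show "range (component (mgrading W) x) \<subseteq> insert 0
          (component (mgrading W) x ` {n. component (mgrading W) x n \<noteq> 0})"
        by auto
      show "countable (insert 0
          (component (mgrading W) x ` {n. component (mgrading W) x n \<noteq> 0}))"
        using decomposes_component[OF m_graded that]
        by (auto simp: decomposes_def intro: countable_finite)
    qed
    moreover have "component (mgrading W) x n \<in> mspace W" if "x \<in> mspace W" for x n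
      using linear_onD(1)[OF linear_on_component[OF m_graded] that] .
    ultimately show ?case
      using Suc cF linear_onD(1)[OF F] by (auto simp: step_def subset_iff intro!: countable_UN)
  qed (simp add: w)
  have sub: "S \<subseteq> mspace W" and cS: "countable S"
    using T by (auto simp: S_def)
  have "w \<in> (step ^^ 0) {w}"
    by simp
  then have wS: "w \<in> S"
    unfolding S_def by blast
  have closed: "step S \<subseteq> S"
  proof
    fix y
    assume "y \<in> step S"
    then obtain i where "y \<in> step ((step ^^ i) {w})"
      unfolding S_def step_def by blast
    then have "y \<in> (step ^^ Suc i) {w}"
      by simp
    then show "y \<in> S"
      unfolding S_def by blast
  qed
  have "f x \<in> cv.span S" if "f \<in> F" "x \<in> cv.span S" for f x
  proof (rule linear_on_span_closed[OF F[OF that(1)] subspace_mspace sub _ that(2)])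
    fix y assume "y \<in> S"
    then have "f y \<in> step S" using that(1) by (auto simp: step_def)
    then show "f y \<in> cv.span S" using closed cv.span_superset by blast
  qed
  note spanF = this
  have spanB: "mmodes W b n x \<in> cv.span S" if "b \<in> B" "x \<in> cv.span S" for b n x
    using spanF[of "mmodes W b n" x] that by (auto simp: F_def)
  have modes: "mmodes W a n x \<in> cv.span S" if x: "x \<in> cv.span S" for a n x
  proof -
    have xW: "x \<in> mspace W"
      using x sub cv.span_minimal[OF _ subspace_mspace] by blast
    have "a \<in> cv.span B"
      using B(2) by simp
    then show ?thesis
    proof (induction rule: cv.span_induct_alt)
      case base
      show ?case
        using linear_on_0[OF mmodes_linear_left[OF xW] cv.subspace_UNIV] cv.span_zero by simp
    next
      case (step c b y)
      then show ?case
        using spanB[OF _ x]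
        by (simp add: linear_onD(2,3)[OF mmodes_linear_left[OF xW]] cv.span_add cv.span_scale)
    qed
  qed
  have comp: "component (mgrading W) x n \<in> cv.span S" if "x \<in> cv.span S" for n x
  proof (rule linear_on_span_closed[OF linear_on_component[OF m_graded] subspace_mspace sub _ that])
    fix y assume "y \<in> S"
    then have "component (mgrading W) y n \<in> step S" unfolding step_def by blast
    then show "component (mgrading W) y n \<in> cv.span S" using closed cv.span_superset by blast
  qed
  show ?thesis
    using that[OF cS wS sub modes comp] spanF by (simp add: F_def)
qed

lemma transported_module:
  fixes \<phi> :: "'w \<Rightarrow> 'x::complex_vector"
  assumes S: "cv.subspace S" "S \<subseteq> mspace W"
    and modes_closed: "\<And>a n x. x \<in> S \<Longrightarrow> mmodes W a n x \<in> S"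
    and comp_closed: "\<And>n x. x \<in> S \<Longrightarrow> component (mgrading W) x n \<in> S"
    and LW0_closed: "\<And>x. x \<in> S \<Longrightarrow> LW0 x \<in> S"
    and LW1_closed: "\<And>x. x \<in> S \<Longrightarrow> LW1 x \<in> S"
    and LW0: "linear_on (mspace W) (mspace W) LW0"
      "\<And>a n w. w \<in> mspace W \<Longrightarrow> LW0 (mmodes W a n w) - mmodes W a n (LW0 w) =
              mmodes W (L0 V a) n w + of_int (- n - 1) *\<^sub>C mmodes W a n w"
      "\<And>n. mgrading W n = {w \<in> mspace W. \<exists>k\<ge>1. ((\<lambda>y. LW0 y - n *\<^sub>C y) ^^ k) w = 0}"
    and LW1: "linear_on (mspace W) (mspace W) LW1"
      "\<And>a n w. w \<in> mspace W \<Longrightarrow>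
              mmodes W (Lm1 V a) n w = of_int (- n) *\<^sub>C mmodes W a (n - 1) w \<and>
              LW1 (mmodes W a n w) - mmodes W a n (LW1 w) = mmodes W (Lm1 V a) n w"
    and \<phi>: "linear_on S UNIV \<phi>" "inj_on \<phi> S"
  defines "W' \<equiv> \<lparr>mspace = \<phi> ` S, mgrading = (\<lambda>n. \<phi> ` (mgrading W n \<inter> S)),
                mmodes = (\<lambda>a n y. \<phi> (mmodes W a n (inv_into S \<phi> y)))\<rparr>"
  shows "lower_bounded_generalized_module V W'"
    and "x \<in> S \<Longrightarrow> \<phi> x \<in> Omega V W' i \<longleftrightarrow> x \<in> Omega V W i"
    and "x \<in> S \<Longrightarrow> mode_kl V W' k l v (\<phi> x) = \<phi> (mode_kl V W k l v x)"
proof -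
  note lin = linear_onD(2,3)[OF \<phi>(1)]
  note \<psi> = inv_into_f_f[OF \<phi>(2)]
  note S_simps = cv.subspace_0[OF S(1)] cv.subspace_add[OF S(1)] cv.subspace_scale[OF S(1)]
    cv.subspace_diff[OF S(1)]
  note \<phi>0 = linear_on_0[OF \<phi>(1) S(1)]
  note \<phi>_Sum_any = linear_on_Sum_any_inj[OF \<phi>(1) S(1) \<phi>(2)]
  have SW: "x \<in> mspace W" if "x \<in> S" for x
    using S(2) that by blast
  have \<phi>_eq_0: "\<phi> x = 0 \<longleftrightarrow> x = 0" if "x \<in> S" for x
    using \<phi>0 inj_onD[OF \<phi>(2), of x 0] S_simps that by auto
  have \<phi>_diff: "\<phi> (x - y) = \<phi> x - \<phi> y" if "x \<in> S" "y \<in> S" for x y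
    using lin(1)[of "x - y" y] that S_simps by (simp add: algebra_simps)
  have G: "cv.subspace (mgrading W n)" for n
    using m_graded by (auto simp: graded_by_def)
  have image_subspace: "cv.subspace (\<phi> ` T)" if T: "cv.subspace T" "T \<subseteq> S" for T
  proof (rule cv.subspaceI)
    show "0 \<in> \<phi> ` T"
      using cv.subspace_0[OF T(1)] \<phi>0 by force
    show "y + z \<in> \<phi> ` T" if "y \<in> \<phi> ` T" "z \<in> \<phi> ` T" for y z
    proof -
      from that obtain y' z' where yz: "y = \<phi> y'" "z = \<phi> z'" "y' \<in> T" "z' \<in> T"
        by blast
      then have "y + z = \<phi> (y' + z')"
        using T(2) by (auto simp: lin subset_iff)
      then show ?thesis
        using cv.subspace_add[OF T(1) yz(3,4)] by blast
    qed
    show "c *\<^sub>C y \<in> \<phi> ` T" if "y \<in> \<phi> ` T" for c y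
    proof -
      from that obtain y' where y: "y = \<phi> y'" "y' \<in> T"
        by blast
      then have "c *\<^sub>C y = \<phi> (c *\<^sub>C y')"
        using T(2) by (auto simp: lin subset_iff)
      then show ?thesis
        using cv.subspace_scale[OF T(1) y(2)] by blast
    qed
  qed
  have W'_simps: "mspace W' = \<phi> ` S" "mgrading W' n = \<phi> ` (mgrading W n \<inter> S)"
    "x \<in> S \<Longrightarrow> mmodes W' a m (\<phi> x) = \<phi> (mmodes W a m x)" for n x a m
    by (simp_all add: W'_def \<psi>)
  have graded': "graded_by (mspace W') (mgrading W')"
    unfolding graded_by_def
  proof (intro conjI allI ballI)
    show "cv.subspace (mspace W')"
      unfolding W'_simps by (rule image_subspace[OF S(1)]) simp
    show "cv.subspace (mgrading W' n)" for n
      unfolding W'_simps by (rule image_subspace) (auto intro: cv.subspace_inter G S(1))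
    show "mgrading W' n \<subseteq> mspace W'" for n
      unfolding W'_simps by blast
    fix y
    assume "y \<in> mspace W'"
    then obtain x where x: "y = \<phi> x" "x \<in> S"
      by (auto simp: W'_simps)
    let ?c = "component (mgrading W) x"
    have c: "decomposes (mgrading W) x ?c"
      using decomposes_component[OF m_graded SW[OF x(2)]] .
    have cS: "?c n \<in> S" for n
      using comp_closed[OF x(2)] .
    have "decomposes (mgrading W') y (\<lambda>n. \<phi> (?c n))"
      using c x(2) cS unfolding decomposes_Sum_any x(1)
      by (auto simp: W'_simps \<phi>_eq_0 \<phi>_Sum_any[symmetric])
    moreover have "f = (\<lambda>n. \<phi> (?c n))" if f: "decomposes (mgrading W') y f" for f
    proof -
      define g where "g n = inv_into S \<phi> (f n)" for n
      have "f n \<in> \<phi> ` (mgrading W n \<inter> S)" for n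
        using f by (auto simp: decomposes_def W'_simps)
      then have g: "f n = \<phi> (g n)" "g n \<in> mgrading W n" "g n \<in> S" for n
        unfolding g_def by (auto simp: \<psi> dest!: meta_spec[of _ n])
      have "\<phi> x = \<phi> (Sum_any g)"
        using f g(3) unfolding decomposes_Sum_any x(1) by (simp add: g(1) \<phi>_Sum_any)
      then have "x = Sum_any g"
        using inj_onD[OF \<phi>(2)] x(2) g(3) subspace_Sum_any[OF S(1)] by metis
      moreover have "finite {n. g n \<noteq> 0}"
        using f g(3) by (simp add: decomposes_def g(1) \<phi>_eq_0)
      ultimately have "decomposes (mgrading W) x g"
        using g(2) by (simp add: decomposes_Sum_any)
      then have "?c = g"
        by (rule component_eqI[OF m_graded SW[OF x(2)]])
      then show ?thesis
        by (simp add: fun_eq_iff g(1))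
    qed
    ultimately show "\<exists>!f. decomposes (mgrading W') y f"
      by blast
  qed
  have jacobi': "jacobi_identity V (mspace W') (mmodes W')"
    unfolding jacobi_identity_def W'_simps(1)
  proof (intro allI ballI)
    fix a b c and l m n :: int
    assume "c \<in> \<phi> ` S"
    then obtain x where x: "c = \<phi> x" "x \<in> S"
      by blast
    have sum: "Sum_any (\<lambda>i::nat. r i *\<^sub>C \<phi> (g i)) = \<phi> (Sum_any (\<lambda>i. r i *\<^sub>C g i))"
      if "\<And>i. g i \<in> S" for r g
      using that by (simp add: \<phi>_Sum_any S_simps lin)
    have mem: "Sum_any (\<lambda>i::nat. r i *\<^sub>C g i) \<in> S" if "\<And>i. g i \<in> S" for r g
      using that by (simp add: subspace_Sum_any[OF S(1)] S_simps)
    have J: "Sum_any (\<lambda>i::nat. (of_int m gchoose i) *\<^sub>C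
            mmodes W (modes V a (l + int i) b) (m + n - int i) x) =
        Sum_any (\<lambda>i::nat. ((-1) ^ i * (of_int l gchoose i)) *\<^sub>C
            mmodes W a (m + l - int i) (mmodes W b (n + int i) x)) -
        Sum_any (\<lambda>i::nat. ((-1) powi (l + int i) * (of_int l gchoose i)) *\<^sub>C
            mmodes W b (n + l - int i) (mmodes W a (m + int i) x))"
      using m_jacobi SW[OF x(2)] unfolding jacobi_identity_def by blast
    show "Sum_any (\<lambda>i::nat. (of_int m gchoose i) *\<^sub>C
            mmodes W' (modes V a (l + int i) b) (m + n - int i) c) =
        Sum_any (\<lambda>i::nat. ((-1) ^ i * (of_int l gchoose i)) *\<^sub>C
            mmodes W' a (m + l - int i) (mmodes W' b (n + int i) c)) -
        Sum_any (\<lambda>i::nat. ((-1) powi (l + int i) * (of_int l gchoose i)) *\<^sub>C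
            mmodes W' b (n + l - int i) (mmodes W' a (m + int i) c))"
      using x(2) J
      by (simp add: x(1) W'_simps modes_closed sum mem \<phi>_diff[symmetric])
  qed
  define LW0' where "LW0' y = \<phi> (LW0 (inv_into S \<phi> y))" for y
  define LW1' where "LW1' y = \<phi> (LW1 (inv_into S \<phi> y))" for y
  have L'_simps: "LW0' (\<phi> x) = \<phi> (LW0 x)" "LW1' (\<phi> x) = \<phi> (LW1 x)" if "x \<in> S" for x
    using that by (simp_all add: LW0'_def LW1'_def \<psi>)
  have pow: "((\<lambda>y. LW0 y - n *\<^sub>C y) ^^ k) x \<in> S \<and>
      ((\<lambda>y. LW0' y - n *\<^sub>C y) ^^ k) (\<phi> x) = \<phi> (((\<lambda>y. LW0 y - n *\<^sub>C y) ^^ k) x)"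
    if "x \<in> S" for n k x
    using that by (induction k) (simp_all add: S_simps LW0_closed L'_simps lin \<phi>_diff)
  show module': "lower_bounded_generalized_module V W'"
  proof (intro lower_bounded_generalized_module.intro lower_bounded_generalized_module_axioms.intro
      grading_restricted_vertex_algebra_axioms graded' jacobi')
    show "linear_on UNIV (mspace W') (\<lambda>a. mmodes W' a n w)" if w: "w \<in> mspace W'" for w n
    proof -
      obtain x where "w = \<phi> x" "x \<in> S"
        using w by (auto simp: W'_simps)
      then show ?thesis
        using linear_onD(2,3)[OF mmodes_linear_left[OF SW]]
        by (simp add: linear_on_def W'_simps modes_closed lin)
    qed
    show "linear_on (mspace W') (mspace W') (mmodes W' a n)" for a n
      using linear_onD(2,3)[OF mmodes_linear_right]
      by (auto simp: linear_on_def W'_simps modes_closed SW S_simps lin[symmetric])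
    show "\<exists>N. \<forall>n. Re n < N \<longrightarrow> mgrading W' n = {0}"
    proof -
      obtain N where "\<And>n. Re n < N \<Longrightarrow> mgrading W n = {0}"
        using m_lower_bounded by blast
      then have "\<forall>n. Re n < N \<longrightarrow> mgrading W' n = {0}"
        by (simp add: W'_simps S_simps \<phi>0)
      then show ?thesis ..
    qed
    show "\<exists>N. \<forall>n\<ge>N. mmodes W' a n w = 0" if w: "w \<in> mspace W'" for w a
    proof -
      obtain x where x: "w = \<phi> x" "x \<in> S"
        using w by (auto simp: W'_simps)
      obtain N where "\<And>n. n \<ge> N \<Longrightarrow> mmodes W a n x = 0"
        using m_truncation[OF SW[OF x(2)]] by blast
      then show ?thesis
        using x by (intro exI[of _ N]) (simp add: W'_simps \<phi>0)
    qed
    show "mmodes W' (vacuum V) n w = (if n = -1 then w else 0)" if w: "w \<in> mspace W'" for w n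
      using w by (auto simp: W'_simps m_vacuum SW \<phi>0)
    have "linear_on (mspace W') (mspace W') LW0'"
      using linear_onD(2,3)[OF LW0(1)]
      by (auto simp: linear_on_def W'_simps L'_simps LW0_closed SW S_simps lin[symmetric])
    moreover have "LW0' (mmodes W' a n w) - mmodes W' a n (LW0' w) =
        mmodes W' (L0 V a) n w + of_int (- n - 1) *\<^sub>C mmodes W' a n w"
      if w: "w \<in> mspace W'" for a n w
    proof -
      obtain x where x: "w = \<phi> x" "x \<in> S"
        using w by (auto simp: W'_simps)
      have "LW0' (mmodes W' a n w) - mmodes W' a n (LW0' w) =
          \<phi> (LW0 (mmodes W a n x) - mmodes W a n (LW0 x))"
        using x by (simp add: W'_simps L'_simps modes_closed LW0_closed \<phi>_diff)
      also have "\<dots> = mmodes W' (L0 V a) n w + of_int (- n - 1) *\<^sub>C mmodes W' a n w"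
        unfolding LW0(2)[OF SW[OF x(2)]]
        using x by (simp only: W'_simps modes_closed S_simps lin)
      finally show ?thesis .
    qed
    moreover have "mgrading W' n =
        {w \<in> mspace W'. \<exists>k\<ge>1. ((\<lambda>y. LW0' y - n *\<^sub>C y) ^^ k) w = 0}" for n
    proof -
      have "(\<exists>k\<ge>1. ((\<lambda>y. LW0' y - n *\<^sub>C y) ^^ k) (\<phi> x) = 0) \<longleftrightarrow>
          (\<exists>k\<ge>1. ((\<lambda>y. LW0 y - n *\<^sub>C y) ^^ k) x = 0)" if "x \<in> S" for x
        using pow[OF that] \<phi>_eq_0 by simp
      then have "{w \<in> \<phi> ` S. \<exists>k\<ge>1. ((\<lambda>y. LW0' y - n *\<^sub>C y) ^^ k) w = 0} =
          \<phi> ` {x \<in> S. \<exists>k\<ge>1. ((\<lambda>y. LW0 y - n *\<^sub>C y) ^^ k) x = 0}"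
        by blast
      also have "{x \<in> S. \<exists>k\<ge>1. ((\<lambda>y. LW0 y - n *\<^sub>C y) ^^ k) x = 0} = mgrading W n \<inter> S"
        unfolding LW0(3) using SW by blast
      finally show ?thesis
        unfolding W'_simps by (rule sym)
    qed
    ultimately show "\<exists>LW0. linear_on (mspace W') (mspace W') LW0 \<and>
        (\<forall>a n. \<forall>w\<in>mspace W'. LW0 (mmodes W' a n w) - mmodes W' a n (LW0 w) =
            mmodes W' (L0 V a) n w + of_int (- n - 1) *\<^sub>C mmodes W' a n w) \<and>
        (\<forall>n. mgrading W' n =
            {w \<in> mspace W'. \<exists>k\<ge>1. ((\<lambda>y. LW0 y - n *\<^sub>C y) ^^ k) w = 0})"
      by (intro exI[of _ LW0'] conjI allI ballI)
    have "linear_on (mspace W') (mspace W') LW1'"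
      using linear_onD(2,3)[OF LW1(1)]
      by (auto simp: linear_on_def W'_simps L'_simps LW1_closed SW S_simps lin[symmetric])
    moreover have "mmodes W' (Lm1 V a) n w = of_int (- n) *\<^sub>C mmodes W' a (n - 1) w \<and>
        LW1' (mmodes W' a n w) - mmodes W' a n (LW1' w) = mmodes W' (Lm1 V a) n w"
      if w: "w \<in> mspace W'" for a n w
    proof -
      obtain x where x: "w = \<phi> x" "x \<in> S"
        using w by (auto simp: W'_simps)
      have "LW1' (mmodes W' a n w) - mmodes W' a n (LW1' w) =
          \<phi> (LW1 (mmodes W a n x) - mmodes W a n (LW1 x))"
        using x by (simp add: W'_simps L'_simps modes_closed LW1_closed \<phi>_diff)
      also have "\<dots> = \<phi> (mmodes W (Lm1 V a) n x)"
        using LW1(2)[OF SW[OF x(2)]] by simp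
      also have "\<dots> = mmodes W' (Lm1 V a) n w"
        using x by (simp only: W'_simps)
      finally have 1: "LW1' (mmodes W' a n w) - mmodes W' a n (LW1' w) = mmodes W' (Lm1 V a) n w" .
      have "mmodes W (Lm1 V a) n x = of_int (- n) *\<^sub>C mmodes W a (n - 1) x"
        using LW1(2)[OF SW[OF x(2)]] by blast
      then have "mmodes W' (Lm1 V a) n w = of_int (- n) *\<^sub>C mmodes W' a (n - 1) w"
        using x by (simp only: W'_simps modes_closed lin)
      with 1 show ?thesis by blast
    qed
    ultimately show "\<exists>LW1. linear_on (mspace W') (mspace W') LW1 \<and>
        (\<forall>a n. \<forall>w\<in>mspace W'.
            mmodes W' (Lm1 V a) n w = of_int (- n) *\<^sub>C mmodes W' a (n - 1) w \<and>
            LW1 (mmodes W' a n w) - mmodes W' a n (LW1 w) = mmodes W' (Lm1 V a) n w)"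
      by (intro exI[of _ LW1'] conjI allI ballI) auto
  qed
  show "\<phi> x \<in> Omega V W' i \<longleftrightarrow> x \<in> Omega V W i" if "x \<in> S"
    using that SW by (auto simp: Omega_def W'_simps \<phi>_eq_0 modes_closed)
  show "mode_kl V W' k l v (\<phi> x) = \<phi> (mode_kl V W k l v x)" if "x \<in> S"
    using that by (simp add: mode_kl_def W'_simps \<phi>_Sum_any modes_closed)
qed

end

theorem Q_inf_subset_theta_kernel:
  fixes W :: "('v::complex_vector, 'w::complex_vector) module_data"
  assumes "lower_bounded_generalized_module V W"
  shows "Q_inf V \<subseteq> theta_kernel V W"
proof
  fix A
  assume A: "A \<in> Q_inf V"
  interpret W: lower_bounded_generalized_module V W
    by fact
  obtain LW0 where LW0: "linear_on (mspace W) (mspace W) LW0"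
      "\<And>a n w. w \<in> mspace W \<Longrightarrow> LW0 (mmodes W a n w) - mmodes W a n (LW0 w) =
              mmodes W (L0 V a) n w + of_int (- n - 1) *\<^sub>C mmodes W a n w"
      "\<And>n. mgrading W n = {w \<in> mspace W. \<exists>k\<ge>1. ((\<lambda>y. LW0 y - n *\<^sub>C y) ^^ k) w = 0}"
    using W.m_L0 by blast
  obtain LW1 where LW1: "linear_on (mspace W) (mspace W) LW1"
      "\<And>a n w. w \<in> mspace W \<Longrightarrow>
              mmodes W (Lm1 V a) n w = of_int (- n) *\<^sub>C mmodes W a (n - 1) w \<and>
              LW1 (mmodes W a n w) - mmodes W a n (LW1 w) = mmodes W (Lm1 V a) n w"
    using W.m_Lm1 by blast
  have transfer: "A \<in> U_inf \<and> mode_kl V W k l (A k l) w \<in> Omega V W (int k - 1)"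
    if w: "w \<in> Omega V W (int l)" for k l w
  proof -
    obtain S where S: "countable S" "w \<in> S" "S \<subseteq> mspace W"
      "\<And>a n x. x \<in> cv.span S \<Longrightarrow> mmodes W a n x \<in> cv.span S"
      "\<And>n x. x \<in> cv.span S \<Longrightarrow> component (mgrading W) x n \<in> cv.span S"
      "\<And>x. x \<in> cv.span S \<Longrightarrow> LW0 x \<in> cv.span S"
      "\<And>x. x \<in> cv.span S \<Longrightarrow> LW1 x \<in> cv.span S"
      using W.countable_submodule[OF W.Omega_mspace[OF w] LW0(1) LW1(1)] by blast
    obtain \<phi> :: "'w \<Rightarrow> nat \<Rightarrow> complex" where
      \<phi>: "linear_on (cv.span S) UNIV \<phi>" "inj_on \<phi> (cv.span S)"
      using countable_embedding[OF S(1)] by blast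
    have sub: "cv.span S \<subseteq> mspace W"
      using S(3) W.subspace_mspace by (rule cv.span_minimal)
    define W' where "W' = \<lparr>mspace = \<phi> ` cv.span S, mgrading = (\<lambda>n. \<phi> ` (mgrading W n \<inter> cv.span S)),
                mmodes = (\<lambda>a n y. \<phi> (mmodes W a n (inv_into (cv.span S) \<phi> y)))\<rparr>"
    note T0 = W.transported_module[of "cv.span S" LW0 LW1 \<phi>, folded W'_def]
    have T1: "lower_bounded_generalized_module V W'"
      by (rule T0(1)[OF cv.subspace_span sub]) (fact S LW0 LW1 \<phi>)+
    have T2: "\<phi> x \<in> Omega V W' i \<longleftrightarrow> x \<in> Omega V W i" if "x \<in> cv.span S" for x i
      by (rule T0(2)[OF cv.subspace_span sub]) (fact S LW0 LW1 \<phi> that)+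
    have T3: "mode_kl V W' k l v (\<phi> x) = \<phi> (mode_kl V W k l v x)" if "x \<in> cv.span S" for x k l v
      by (rule T0(3)[OF cv.subspace_span sub]) (fact S LW0 LW1 \<phi> that)+
    interpret W': lower_bounded_generalized_module V W'
      by (rule T1)
    have wS: "w \<in> cv.span S"
      using S(2) by (rule cv.span_base)
    have "A \<in> theta_kernel V W'"
      using A T1 unfolding Q_inf_def by blast
    then have AU: "A \<in> U_inf" and "mode_kl V W' k l (A k l) (\<phi> w) \<in> Omega V W' (int k - 1)"
      using T2[OF wS] w by (auto simp: W'.theta_kernel_iff)
    then have "\<phi> (mode_kl V W k l (A k l) w) \<in> Omega V W' (int k - 1)"
      by (simp add: T3[OF wS])
    moreover have "mode_kl V W k l (A k l) w \<in> cv.span S"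
      unfolding mode_kl_def by (intro subspace_Sum_any cv.subspace_span S(4) wS)
    ultimately show ?thesis
      using T2 AU by blast
  qed
  have "0 \<in> Omega V W (int 0)"
    by (rule cv.subspace_0[OF W.subspace_Omega])
  then have "A \<in> U_inf"
    using transfer by blast
  with transfer show "A \<in> theta_kernel V W"
    by (simp add: W.theta_kernel_iff)
qed


section \<open>The subspaces spanned by the known relations\<close>

text \<open>
  An infinite linear combination in which each \<open>(k,l)\<close> occurs finitely often is a column-finite
  matrix each of whose entries is a finite linear combination of generators.
\<close>

definition O_entry_gens ::
  "'v::complex_vector vertex_algebra_data \<Rightarrow> nat \<Rightarrow> nat \<Rightarrow> 'v set" where
  "O_entry_gens V k l =
     {res V (- int k - int l - int p - 2) (int l) u v | u v p. True} \<union>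
     {Lm1 V v + L0 V v + of_int (int l - int k) *\<^sub>C v | v. True}"

definition O_inf :: "'v::complex_vector vertex_algebra_data \<Rightarrow> 'v matrix set" where
  "O_inf V = {A \<in> U_inf. \<forall>k l. A k l \<in> cv.span (O_entry_gens V k l)}"

text \<open>\<open>N\<close> is the weight of \<open>v\<close>.\<close>

definition J_gen :: "'v::complex_vector vertex_algebra_data \<Rightarrow>
    nat \<Rightarrow> int \<Rightarrow> int \<Rightarrow> int \<Rightarrow> int \<Rightarrow> 'v \<Rightarrow> 'v \<Rightarrow> 'v matrix" where
  "J_gen V k l p n N u v =
     (\<Sum>j | n + p - int j \<ge> 0. ((-1) ^ j * (of_int p gchoose j)) *\<^sub>C
        diamond V (elem_matrix k (nat (n + p - int j)) v)
                  (elem_matrix (nat (n + p - int j)) (nat (l + p)) u)) -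
     (\<Sum>j | l - n + int k + p - int j \<ge> 0. ((-1) powi (p - int j) * (of_int p gchoose j)) *\<^sub>C
        diamond V (elem_matrix k (nat (l - n + int k + p - int j)) u)
                  (elem_matrix (nat (l - n + int k + p - int j)) (nat (l + p)) v)) -
     Sum_any (\<lambda>j::nat. (of_int (N + n - int k - 1) gchoose j) *\<^sub>C
        elem_matrix k (nat (l + p)) (modes V v (p + int j) u))"

definition J_inf :: "'v::complex_vector vertex_algebra_data \<Rightarrow> 'v matrix set" where
  "J_inf V = cv.span {J_gen V k l p n N u v | k l p n N u v. l + p \<ge> 0 \<and> v \<in> grading V N}"


section \<open>The rank one Heisenberg vertex operator algebra\<close>

text \<open>
  \<open>Alpha m\<close> and \<open>Central\<close> form a basis of the affine Heisenberg Lie algebra. A word in this basis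
  stands for a monomial in the tensor algebra, which is the free vector space on all words.
\<close>

datatype heis = Alpha int | Central

abbreviation word :: "heis list \<Rightarrow> heis list \<Rightarrow>\<^sub>0 complex" where
  "word w \<equiv> Poly_Mapping.single w 1"

text \<open>\<open>[h, g] = bracket_coeff h g *\<^sub>C Central\<close>\<close>

fun bracket_coeff :: "heis \<Rightarrow> heis \<Rightarrow> complex" where
  "bracket_coeff (Alpha m) (Alpha n) = (if m + n = 0 then of_int m else 0)"
| "bracket_coeff _ _ = 0"

text \<open>
  Inducing the one-dimensional module, on which \<open>Alpha m\<close> (\<open>m \<ge> 0\<close>) acts as 0 and \<open>Central\<close> as 1,
  amounts to dividing the tensor algebra by the two-sided ideal defining the universal enveloping
  algebra and by the left ideal generated by \<open>Alpha m\<close> (\<open>m \<ge> 0\<close>) and \<open>Central - 1\<close>.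
\<close>

definition fock_relations :: "(heis list \<Rightarrow>\<^sub>0 complex) set" where
  "fock_relations = cv.span (
     {word (u @ [h, g] @ w) - word (u @ [g, h] @ w)
        - bracket_coeff h g *\<^sub>C word (u @ [Central] @ w) | u h g w. True} \<union>
     {word (u @ [Alpha m]) | u m. m \<ge> 0} \<union>
     {word (u @ [Central]) - word u | u. True})"

lemma subspace_fock_relations: "cv.subspace fock_relations"
  unfolding fock_relations_def by (rule cv.subspace_span)

quotient_type fock = "heis list \<Rightarrow>\<^sub>0 complex" / "\<lambda>x y. x - y \<in> fock_relations"
proof (rule equivpI)
  show "reflp (\<lambda>x y. x - y \<in> fock_relations)"
    by (simp add: reflp_def cv.subspace_0[OF subspace_fock_relations])
  show "symp (\<lambda>x y. x - y \<in> fock_relations)"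
    unfolding symp_def by (metis cv.subspace_neg[OF subspace_fock_relations] minus_diff_eq)
  show "transp (\<lambda>x y. x - y \<in> fock_relations)"
  proof (rule transpI)
    fix x y z
    assume "x - y \<in> fock_relations" "y - z \<in> fock_relations"
    then have "(x - y) + (y - z) \<in> fock_relations"
      by (rule cv.subspace_add[OF subspace_fock_relations])
    then show "x - z \<in> fock_relations"
      by simp
  qed
qed

instantiation fock :: complex_vector
begin

lift_definition zero_fock :: fock is 0 .

lift_definition plus_fock :: "fock \<Rightarrow> fock \<Rightarrow> fock" is "(+)"
  unfolding add_diff_add by (rule cv.subspace_add[OF subspace_fock_relations])

lift_definition uminus_fock :: "fock \<Rightarrow> fock" is uminus
  unfolding minus_diff_minus by (rule cv.subspace_neg[OF subspace_fock_relations])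

lift_definition minus_fock :: "fock \<Rightarrow> fock \<Rightarrow> fock" is "(-)"
proof -
  fix a b c d
  assume "a - b \<in> fock_relations" "c - d \<in> fock_relations"
  then have "(a - b) - (c - d) \<in> fock_relations"
    by (rule cv.subspace_diff[OF subspace_fock_relations])
  then show "(a - c) - (b - d) \<in> fock_relations"
    by (simp add: diff_diff_eq2 diff_diff_eq add_diff_eq diff_add_eq add.commute)
qed

lift_definition scaleC_fock :: "complex \<Rightarrow> fock \<Rightarrow> fock" is scaleC
  unfolding cv.scale_right_diff_distrib[symmetric]
  by (rule cv.subspace_scale[OF subspace_fock_relations])

instance
proof
  fix a b c :: fock and r s :: complex
  note [simp] = cv.subspace_0[OF subspace_fock_relations]
  show "a + b + c = a + (b + c)" by transfer (simp add: add.assoc)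
  show "a + b = b + a" by transfer (simp add: add.commute)
  show "0 + a = a" by transfer simp
  show "- a + a = 0" by transfer simp
  show "a - b = a + - b" by transfer simp
  show "r *\<^sub>C (a + b) = r *\<^sub>C a + r *\<^sub>C b" by transfer (simp add: scaleC_add_right)
  show "(r + s) *\<^sub>C a = r *\<^sub>C a + s *\<^sub>C a" by transfer (simp add: scaleC_add_left)
  show "r *\<^sub>C s *\<^sub>C a = (r * s) *\<^sub>C a" by transfer (simp add: scaleC_scaleC)
  show "1 *\<^sub>C a = a" by transfer (simp add: scaleC_one)
qed

end

text \<open>Left multiplication by a basis element, sending each word \<open>w\<close> to \<open>h # w\<close>.\<close>

lift_definition prepend :: "heis \<Rightarrow> (heis list \<Rightarrow>\<^sub>0 complex) \<Rightarrow> heis list \<Rightarrow>\<^sub>0 complex"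
  is "\<lambda>h f w. case w of [] \<Rightarrow> 0 | g # w' \<Rightarrow> if g = h then f w' else 0"
proof -
  fix h :: heis and f :: "heis list \<Rightarrow> complex"
  assume "finite {w. f w \<noteq> 0}"
  moreover have "{w. (case w of [] \<Rightarrow> 0 | g # w' \<Rightarrow> if g = h then f w' else 0) \<noteq> 0}
      \<subseteq> (#) h ` {w. f w \<noteq> 0}"
  proof
    fix x assume "x \<in> {w. (case w of [] \<Rightarrow> 0 | g # w' \<Rightarrow> if g = h then f w' else 0) \<noteq> 0}"
    then show "x \<in> (#) h ` {w. f w \<noteq> 0}"
      by (cases x) (auto split: if_splits)
  qed
  ultimately show "finite {w. (case w of [] \<Rightarrow> 0 | g # w' \<Rightarrow> if g = h then f w' else 0) \<noteq> 0}"
    by (meson finite_imageI finite_subset)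
qed

lemma prepend_diff: "prepend h (x - y) = prepend h x - prepend h y"
  by transfer (auto simp: fun_eq_iff split: list.splits)

lemma prepend_add: "prepend h (x + y) = prepend h x + prepend h y"
  by transfer (auto simp: fun_eq_iff split: list.splits)

lemma prepend_scaleC: "prepend h (c *\<^sub>C x) = c *\<^sub>C prepend h x"
  by transfer (auto simp: fun_eq_iff scaleC_complex_def split: list.splits)

lemma prepend_word [simp]: "prepend h (word w) = word (h # w)"
  by transfer (auto simp: fun_eq_iff when_def split: list.splits)

lemma prepend_relations:
  assumes "x \<in> fock_relations"
  shows "prepend h x \<in> fock_relations"
  using assms unfolding fock_relations_def
proof (induction rule: cv.span_induct_alt)
  case base
  have "prepend h 0 = 0"
    using prepend_diff[of h 0 0] by simp
  then show ?case
    by (simp add: cv.span_zero)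
next
  case (step c x y)
  consider u a b w where "x = word (u @ [a, b] @ w) - word (u @ [b, a] @ w)
        - bracket_coeff a b *\<^sub>C word (u @ [Central] @ w)"
    | u m where "x = word (u @ [Alpha m])" "m \<ge> 0"
    | u where "x = word (u @ [Central]) - word u"
    using step(1) by blast
  then have "prepend h x \<in> 
     {word (u @ [h, g] @ w) - word (u @ [g, h] @ w)
        - bracket_coeff h g *\<^sub>C word (u @ [Central] @ w) | u h g w. True} \<union>
     {word (u @ [Alpha m]) | u m. m \<ge> 0} \<union>
     {word (u @ [Central]) - word u | u. True}"
  proof cases
    case (1 u a b w)
    have "prepend h x = word ((h # u) @ [a, b] @ w) - word ((h # u) @ [b, a] @ w)
        - bracket_coeff a b *\<^sub>C word ((h # u) @ [Central] @ w)"
      unfolding 1 prepend_diff prepend_scaleC prepend_word append_Cons ..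
    then show ?thesis by blast
  next
    case (2 u m)
    have "prepend h x = word ((h # u) @ [Alpha m])"
      unfolding 2 prepend_word append_Cons ..
    then show ?thesis using 2 by blast
  next
    case (3 u)
    have "prepend h x = word ((h # u) @ [Central]) - word (h # u)"
      unfolding 3 prepend_diff prepend_word append_Cons ..
    then show ?thesis by blast
  qed
  then show ?case
    using step(2) by (simp add: prepend_add prepend_scaleC cv.span_add cv.span_scale cv.span_base)
qed

lift_definition heis_act :: "heis \<Rightarrow> fock \<Rightarrow> fock" is prepend
  by (simp flip: prepend_diff add: prepend_relations)

lift_definition fock_vacuum :: fock is "word []" .

abbreviation alpha :: "int \<Rightarrow> fock \<Rightarrow> fock" where
  "alpha m \<equiv> heis_act (Alpha m)"

text \<open>
  Spanned by \<open>alpha (- i\<^sub>1) (\<dots> (alpha (- i\<^sub>j) fock_vacuum))\<close> with positive \<open>i\<^sub>1, \<dots>, i\<^sub>j\<close> of sum \<open>n\<close>.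
\<close>

definition fock_grading :: "int \<Rightarrow> fock set" where
  "fock_grading n = cv.span
     {foldr (\<lambda>i. alpha (- i)) is fock_vacuum | is. (\<forall>i\<in>set is. i > 0) \<and> sum_list is = n}"

text \<open>
  The generating field \<open>Y(\<alpha>(-1)1, x)\<close> determines all vertex operators, so \<open>M\<close> is the standard
  vertex algebra structure on the Fock space.
\<close>

locale heisenberg_voa = grading_restricted_vertex_algebra M
  for M :: "fock vertex_algebra_data" +
  assumes grading_eq: "grading M = fock_grading"
    and vacuum_eq: "vacuum M = fock_vacuum"
    and modes_alpha: "modes M (alpha (-1) fock_vacuum) n = alpha n"

end

theory Submission
  imports Defs
begin

text \<open>
  The relations in \<open>O\<close> and \<open>J\<close> hold in every module, whatever grading by natural numbers it
  carries, provided that a vector of weight \<open>N\<close> has its \<open>j\<close>-th mode of degree \<open>N - j - 1\<close>. The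
  relations in \<open>Q\<close> only have to hold for the particular grading by the filtration \<open>\<Omega>\<close>, in which level
  0 contains all vectors killed by every mode of negative degree. Shifting the grading of a module
  upwards, so that level 0 becomes zero and the vacuum-like vectors sit in level 1, preserves the
  first property and destroys the second. Hence an entry \<open>(1,1)\<close> that vanishes on the usual level 1
  of every module but not on its usual level 0 separates \<open>Q\<close> from the ideal generated by \<open>O\<close> and \<open>J\<close>.

  For the Heisenberg algebra such an entry is
  \<open>\<alpha>(-1)\<^sup>2 1 - \<alpha>(-2)\<^sup>2 1 - 2 1\<close>. On vectors killed by \<open>\<alpha>(m)\<close> for \<open>m \<ge> 2\<close> the zero modes of the first
  two summands are \<open>\<alpha>(0)\<^sup>2 + 2 \<alpha>(-1) \<alpha>(1)\<close> and \<open>\<alpha>(0)\<^sup>2\<close>; the mode \<open>\<alpha>(1)\<close> drops out of the second one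
  because the field of \<open>\<alpha>(-2) 1\<close> is the derivative of the field of \<open>\<alpha>(-1) 1\<close>. So the zero mode of the
  entry is \<open>2 (\<alpha>(-1) \<alpha>(1) - 1)\<close>, which measures the distance from level 1. It maps \<open>\<Omega>\<^sub>1(W)\<close> into
  \<open>\<Omega>\<^sub>0(W)\<close> for every \<open>W\<close> (\<open>level_detector_theta_kernel\<close>), but sends the vacuum to \<open>-2\<close> times itself.

  For the other half, \<open>act_res\<close> rewrites a residue of the kind used in \<open>\<diamond>\<close> and \<open>O\<close> as a combination of
  products of two operators passing through the levels \<open>0, 1, 2, \<dots>\<close>, since modes below level 0
  vanish. This makes \<open>\<diamond>\<close> act as composition (\<open>act_diamond_entry\<close>), makes \<open>O\<close> act as zero, and turns
  the relations in \<open>J\<close> into the Jacobi identity (\<open>commutator_on_levels\<close>). The matrices acting as zero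
  thus form a two-sided ideal containing \<open>O\<close> and \<open>J\<close> (\<open>generated_ideal_annihilated\<close>). The module used
  is \<open>M(1)\<close> itself with its grading shifted by one.
\<close>


section \<open>Linear maps given by sums\<close>

abbreviation is_linear :: "('a::complex_vector \<Rightarrow> 'b::complex_vector) \<Rightarrow> bool" where
  "is_linear \<equiv> linear_on UNIV UNIV"

lemma is_linearI:
  assumes "\<And>x y. f (x + y) = f x + f y" "\<And>c x. f (c *\<^sub>C x) = c *\<^sub>C f x"
  shows "is_linear f"
  using assms by (simp add: linear_on_def)

lemmas is_linear_add = linear_onD(2)[OF _ UNIV_I UNIV_I, of UNIV]
lemmas is_linear_scale = linear_onD(3)[OF _ UNIV_I, of UNIV]
lemmas is_linear_0 = linear_on_0[OF _ cv.subspace_UNIV, of UNIV]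
lemmas is_linear_sum = linear_on_sum[OF _ cv.subspace_UNIV UNIV_I, of UNIV]

lemma is_linear_diff: "is_linear f \<Longrightarrow> f (x - y) = f x - f y"
  using is_linear_add[of f "x - y" y] by (simp add: algebra_simps)

lemma is_linear_comp: "is_linear f \<Longrightarrow> is_linear g \<Longrightarrow> is_linear (\<lambda>x. f (g x))"
  by (simp add: linear_on_def)

lemma is_linear_zero: "is_linear (\<lambda>_. 0)"
  by (rule is_linearI) simp_all

lemma is_linear_plus: "is_linear f \<Longrightarrow> is_linear g \<Longrightarrow> is_linear (\<lambda>x. f x + g x)"
  by (rule is_linearI) (simp_all add: is_linear_add is_linear_scale cv.scale_right_distrib)

lemma is_linear_minus: "is_linear f \<Longrightarrow> is_linear g \<Longrightarrow> is_linear (\<lambda>x. f x - g x)"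
  by (rule is_linearI) (simp_all add: is_linear_add is_linear_scale cv.scale_right_diff_distrib)

lemma is_linear_scaleC: "is_linear f \<Longrightarrow> is_linear (\<lambda>x. c *\<^sub>C f x)"
  by (rule is_linearI)
    (simp_all add: is_linear_add is_linear_scale cv.scale_right_distrib cv.scale_left_commute)

lemma is_linear_sum_pointwise:
  assumes "\<And>i. i \<in> I \<Longrightarrow> is_linear (f i)"
  shows "is_linear (\<lambda>x. \<Sum>i\<in>I. f i x)"
proof (rule is_linearI)
  show "(\<Sum>i\<in>I. f i (x + y)) = (\<Sum>i\<in>I. f i x) + (\<Sum>i\<in>I. f i y)" for x y
    unfolding sum.distrib[symmetric] by (rule sum.cong) (simp_all add: is_linear_add assms)
  show "(\<Sum>i\<in>I. f i (c *\<^sub>C x)) = c *\<^sub>C (\<Sum>i\<in>I. f i x)" for c x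
    unfolding cv.scale_sum_right by (rule sum.cong) (simp_all add: is_linear_scale assms)
qed

lemma Sum_any_scaleC:
  assumes "finite {i. g i \<noteq> 0}"
  shows "Sum_any (\<lambda>i. c *\<^sub>C g i) = c *\<^sub>C Sum_any g"
proof -
  have "Sum_any (\<lambda>i. c *\<^sub>C g i) = (\<Sum>i | g i \<noteq> 0. c *\<^sub>C g i)"
    by (rule Sum_any.expand_superset[OF assms]) auto
  then show ?thesis
    by (simp add: Sum_any.expand_set cv.scale_sum_right)
qed

lemma is_linear_Sum_any_pointwise:
  assumes "\<And>i. is_linear (f i)" "\<And>x. finite {i. f i x \<noteq> 0}"
  shows "is_linear (\<lambda>x. Sum_any (\<lambda>i. f i x))"
  by (rule is_linearI)
    (simp_all add: is_linear_add[OF assms(1)] is_linear_scale[OF assms(1)]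
      Sum_any.distrib[OF assms(2,2)] Sum_any_scaleC[OF assms(2)])

lemma is_linear_Sum_any:
  assumes "is_linear f" "finite {i. g i \<noteq> 0}"
  shows "f (Sum_any g) = Sum_any (\<lambda>i. f (g i))"
proof -
  have "Sum_any (\<lambda>i. f (g i)) = (\<Sum>i | g i \<noteq> 0. f (g i))"
    by (rule Sum_any.expand_superset[OF assms(2)]) (auto simp: is_linear_0[OF assms(1)])
  then show ?thesis
    by (simp add: Sum_any.expand_set is_linear_sum[OF assms(1)])
qed

lemma Sum_any_gbinomial_0:
  "Sum_any (\<lambda>i::nat. (c i * (0 gchoose i)) *\<^sub>C g i) = c 0 *\<^sub>C (g 0 :: 'a::complex_vector)"
proof -
  have "(\<lambda>i::nat. (c i * (0 gchoose i)) *\<^sub>C g i) = (\<lambda>i. if i = 0 then c 0 *\<^sub>C g 0 else 0)"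
    by (auto simp: fun_eq_iff gbinomial_0_left)
  then show ?thesis
    by (simp only: Sum_any.delta)
qed

lemma Sum_any_two:
  fixes g :: "nat \<Rightarrow> 'x::comm_monoid_add"
  assumes "\<And>i. i \<ge> 2 \<Longrightarrow> g i = 0"
  shows "Sum_any g = g 0 + g 1"
proof -
  have "{i. g i \<noteq> 0} \<subseteq> {0, 1}"
  proof
    fix i
    assume "i \<in> {i. g i \<noteq> 0}"
    then have "\<not> i \<ge> 2"
      using assms by blast
    then show "i \<in> {0, 1}"
      by auto
  qed
  then have "Sum_any g = sum g {0, 1}"
    by (intro Sum_any.expand_superset) simp_all
  then show ?thesis by simp
qed

lemma vanishes_on_span:
  assumes "is_linear f" "\<And>x. x \<in> S \<Longrightarrow> f x = 0" "x \<in> cv.span S"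
  shows "f x = 0"
proof -
  have "cv.subspace {x. f x = 0}"
    by (rule cv.subspaceI)
      (auto simp: is_linear_0[OF assms(1)] is_linear_add[OF assms(1)] is_linear_scale[OF assms(1)])
  then have "cv.span S \<subseteq> {x. f x = 0}"
    using assms(2) by (intro cv.span_minimal) auto
  with assms(3) show ?thesis by blast
qed


section \<open>Reduction to homogeneous vectors\<close>

context grading_restricted_vertex_algebra
begin

lemma finite_components: "finite {N. component (grading V) v N \<noteq> 0}"
  using decomposes_component[OF graded, of v] by (simp add: decomposes_def)

lemma is_linear_componentwise:
  assumes "\<And>N. is_linear (f N)"
  shows "is_linear (\<lambda>v. Sum_any (\<lambda>N. f N (component (grading V) v N)))"
proof (rule is_linear_Sum_any_pointwise)
  show "is_linear (\<lambda>v. f N (component (grading V) v N))" for N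
    by (intro is_linear_comp[OF assms] linear_on_component graded)
  show "finite {N. f N (component (grading V) v N) \<noteq> 0}" for v
    by (rule finite_subset[OF _ finite_components[of v]]) (auto simp: is_linear_0[OF assms])
qed

lemma componentwise_homogeneous:
  assumes "\<And>N. f N 0 = 0" "v \<in> grading V N"
  shows "Sum_any (\<lambda>N. f N (component (grading V) v N)) = f N v"
proof -
  have "(\<lambda>M. f M (component (grading V) v M)) = (\<lambda>M. if M = N then f N v else 0)"
    by (auto simp: component_homogeneous[OF graded assms(2)] assms(1))
  then show ?thesis by (simp only: Sum_any.delta)
qed

lemma homogeneous_ext:
  assumes "is_linear f" "is_linear g" "\<And>N v. v \<in> grading V N \<Longrightarrow> f v = g v"
  shows "f v = g v"
proof -
  have v: "v = (\<Sum>N | component (grading V) v N \<noteq> 0. component (grading V) v N)"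
    using decomposes_component[OF graded, of v] by (simp add: decomposes_def)
  have "f (component (grading V) v N) = g (component (grading V) v N)" for N
    by (rule assms(3), rule component_mem[OF graded]) simp
  then show ?thesis
    by (subst (1 2) v) (simp add: is_linear_sum[OF assms(1)] is_linear_sum[OF assms(2)])
qed

lemma finite_modes: "finite {i::nat. modes V u (s + int i) v \<noteq> 0}"
proof -
  obtain N where "\<forall>n\<ge>N. modes V u n v = 0"
    using truncation by blast
  then have "\<not> N \<le> s + int i" if "modes V u (s + int i) v \<noteq> 0" for i
    using that by blast
  then have "{i::nat. modes V u (s + int i) v \<noteq> 0} \<subseteq> {..nat (N - s)}"
    by fastforce
  then show ?thesis
    by (rule finite_subset) simp
qed

lemma finite_scaled_modes: "finite {i::nat. c i *\<^sub>C modes V u (s + int i) v \<noteq> 0}"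
  by (rule finite_subset[OF _ finite_modes[of u s v]]) auto

lemma is_linear_scaled_modes:
  "is_linear (\<lambda>u. Sum_any (\<lambda>i::nat. c i *\<^sub>C modes V u (s + int i) v))"
  by (intro is_linear_Sum_any_pointwise is_linear_scaleC modes_linear_left finite_scaled_modes)

lemma res_linear_left: "is_linear (\<lambda>u. res V s l u v)"
  unfolding res_def by (rule is_linear_componentwise) (rule is_linear_scaled_modes)

lemma res_linear_right: "is_linear (res V s l u)"
  unfolding res_def
proof (rule is_linear_Sum_any_pointwise)
  show "is_linear (\<lambda>v. Sum_any (\<lambda>i::nat. (of_int (l + N) gchoose i) *\<^sub>C
          modes V (component (grading V) u N) (s + int i) v))" for N
    by (intro is_linear_Sum_any_pointwise is_linear_scaleC modes_linear_right finite_scaled_modes)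
  show "finite {N. Sum_any (\<lambda>i::nat. (of_int (l + N) gchoose i) *\<^sub>C
          modes V (component (grading V) u N) (s + int i) v) \<noteq> 0}" for v
    by (rule finite_subset[OF _ finite_components[of u]])
      (auto simp: is_linear_0[OF modes_linear_left])
qed

lemma res_homogeneous:
  assumes "u \<in> grading V N"
  shows "res V s l u v = Sum_any (\<lambda>i::nat. (of_int (l + N) gchoose i) *\<^sub>C modes V u (s + int i) v)"
  unfolding res_def
  by (rule componentwise_homogeneous[OF _ assms]) (rule is_linear_0[OF is_linear_scaled_modes])

lemma diamond_entry_0 [simp]:
  "diamond_entry V k n l 0 v = 0" "diamond_entry V k n l u 0 = 0"
  by (simp_all add: diamond_entry_def is_linear_0[OF res_linear_left] is_linear_0[OF res_linear_right])

lemma U_inf_diamond: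
  assumes "A \<in> U_inf" "B \<in> U_inf"
  shows "diamond V A B \<in> U_inf"
  unfolding U_inf_def
proof (intro CollectI allI)
  fix l
  have "k \<in> (\<Union>n\<in>{n. B n l \<noteq> 0}. {k. A k n \<noteq> 0})" if k: "diamond V A B k l \<noteq> 0" for k
  proof (rule ccontr)
    assume "\<not> ?thesis"
    then have "diamond_entry V k n l (A k n) (B n l) = 0" for n
      by (cases "B n l = 0") auto
    with k show False
      by (simp add: diamond_def)
  qed
  then have "{k. diamond V A B k l \<noteq> 0} \<subseteq> (\<Union>n\<in>{n. B n l \<noteq> 0}. {k. A k n \<noteq> 0})"
    by blast
  moreover have "finite (\<Union>n\<in>{n. B n l \<noteq> 0}. {k. A k n \<noteq> 0})"
    using assms by (auto simp: U_inf_def)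
  ultimately show "finite {k. diamond V A B k l \<noteq> 0}"
    by (rule finite_subset)
qed

end


section \<open>The action on a module with an arbitrary grading by natural numbers\<close>

text \<open>
  By trinomial revision the summands are those of \<open>(1 - 1)\<^sup>t\<close>, up to a common factor. This is the
  reason for the binomial coefficients in the definition of \<open>\<diamond>\<close>.
\<close>

lemma gbinomial_cancellation:
  fixes q :: complex
  shows "(\<Sum>m\<le>t. (q gchoose m) * ((-1) ^ (t - m) * ((q - of_nat m) gchoose (t - m)))) =
           (if t = 0 then 1 else 0)"
proof -
  have "(q gchoose m) * ((-1) ^ (t - m) * ((q - of_nat m) gchoose (t - m))) =
      (q gchoose t) * ((-1) ^ t * ((-1) ^ m * of_nat (t choose m)))" if "m \<le> t" for m
  proof -
    have "(q gchoose m) * ((q - of_nat m) gchoose (t - m)) = (q gchoose t) * of_nat (t choose m)"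
      using gbinomial_trinomial_revision[OF that, of q] by (simp add: binomial_gbinomial)
    moreover have "(-1) ^ (t - m) = ((-1) ^ t * (-1) ^ m :: complex)"
      using that by (simp add: power_diff minus_one_power_iff)
    ultimately show ?thesis
      by (metis (no_types, lifting) mult.assoc mult.left_commute)
  qed
  then have "(\<Sum>m\<le>t. (q gchoose m) * ((-1) ^ (t - m) * ((q - of_nat m) gchoose (t - m)))) =
      (q gchoose t) * ((-1) ^ t * (\<Sum>m\<le>t. (-1) ^ m * of_nat (t choose m)))"
    by (simp add: sum_distrib_left)
  then show ?thesis
    by (cases "t = 0") (simp_all add: choose_alternating_sum)
qed

text \<open>
  The grading \<open>G\<close> is tied to the action only by the degrees of the modes; it need not come from
  weights or from the filtration \<open>\<Omega>\<close>, which leaves the freedom to shift it. Levels are integers,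
  those below 0 being zero, so that truncated sums need no case distinctions.
\<close>

locale nat_graded_module = grading_restricted_vertex_algebra V
  for V :: "'v::complex_vector vertex_algebra_data" +
  fixes Y :: "'v \<Rightarrow> int \<Rightarrow> 'w::complex_vector \<Rightarrow> 'w" and G :: "int \<Rightarrow> 'w set"
  assumes Y_linear_left: "is_linear (\<lambda>v. Y v n w)"
    and Y_linear_right: "is_linear (Y v n)"
    and Y_jacobi: "jacobi_identity V UNIV Y"
    and Y_Lm1: "Y (Lm1 V v) n w = of_int (- n) *\<^sub>C Y v (n - 1) w"
    and subspace_G: "cv.subspace (G n)"
    and G_neg: "n < 0 \<Longrightarrow> G n = {0}"
    and Y_degree: "v \<in> grading V N \<Longrightarrow> w \<in> G l \<Longrightarrow> Y v j w \<in> G (l + N - j - 1)"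
begin

text \<open>
  The component of the action of \<open>v\<close> that maps level \<open>l\<close> to level \<open>k\<close>; the analogue of
  \<^const>\<open>mode_kl\<close> for the grading \<open>G\<close>.
\<close>

definition act :: "int \<Rightarrow> int \<Rightarrow> 'v \<Rightarrow> 'w \<Rightarrow> 'w" where
  "act k l v w = Sum_any (\<lambda>N. Y (component (grading V) v N) (N + l - k - 1) w)"

lemma act_linear_left: "is_linear (\<lambda>v. act k l v w)"
  unfolding act_def by (rule is_linear_componentwise) (rule Y_linear_left)

lemma act_linear_right: "is_linear (act k l v)"
  unfolding act_def
proof (rule is_linear_Sum_any_pointwise)
  show "is_linear (Y (component (grading V) v N) (N + l - k - 1))" for N
    by (rule Y_linear_right)
  show "finite {N. Y (component (grading V) v N) (N + l - k - 1) w \<noteq> 0}" for w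
    by (rule finite_subset[OF _ finite_components[of v]]) (auto simp: is_linear_0[OF Y_linear_left])
qed

lemma act_homogeneous: "v \<in> grading V N \<Longrightarrow> act k l v w = Y v (N + l - k - 1) w"
  unfolding act_def by (rule componentwise_homogeneous) (simp_all add: is_linear_0[OF Y_linear_left])

lemma act_0 [simp]: "act k l 0 w = 0" "act k l v 0 = 0"
  by (simp_all add: is_linear_0[OF act_linear_left] is_linear_0[OF act_linear_right])

lemma act_mem:
  assumes "w \<in> G l"
  shows "act k l v w \<in> G k"
proof -
  have "Y (component (grading V) v N) (N + l - k - 1) w \<in> G k" for N
    using Y_degree[OF component_mem[OF graded, of v N] assms, of "N + l - k - 1"] by simp
  then show ?thesis
    unfolding act_def by (intro subspace_Sum_any[OF subspace_G])
qed

lemma act_negative: "w \<in> G l \<Longrightarrow> k < 0 \<Longrightarrow> act k l v w = 0"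
  using act_mem G_neg by blast

lemma jacobi_at:
  "Sum_any (\<lambda>i::nat. (of_int m gchoose i) *\<^sub>C Y (modes V a (l + int i) b) (m + n - int i) w) =
     Sum_any (\<lambda>i::nat. ((-1) ^ i * (of_int l gchoose i)) *\<^sub>C
                Y a (m + l - int i) (Y b (n + int i) w)) -
     Sum_any (\<lambda>i::nat. ((-1) powi (l + int i) * (of_int l gchoose i)) *\<^sub>C
                Y b (n + l - int i) (Y a (m + int i) w))"
  using Y_jacobi unfolding jacobi_identity_def by blast

text \<open>
  For \<open>u\<close> of weight \<open>M\<close> the factor \<open>(1 + x)\<^bsup>l + M\<^esup>\<close> of the residue supplies exactly the binomial
  coefficients on the left-hand side of the Jacobi identity with \<open>m = l + M\<close>. For this \<open>m\<close> the terms
  in which \<open>u\<close> acts first vanish, because they would take \<open>w\<close> from level \<open>l\<close> below level 0. What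
  remains are products with \<open>v\<close> acting first, cut off when the intermediate level becomes negative.
\<close>

lemma act_res:
  assumes w: "w \<in> G l"
  shows "act k l (res V L l u v) w = (\<Sum>i | int i \<le> k + l + L + 1.
           ((-1) ^ i * (of_int L gchoose i)) *\<^sub>C
             act k (k + l + L + 1 - int i) u (act (k + l + L + 1 - int i) l v w))"
proof -
  let ?I = "{i. int i \<le> k + l + L + 1}"
  let ?T = "\<lambda>u v i. ((-1) ^ i * (of_int L gchoose i)) *\<^sub>C
              act k (k + l + L + 1 - int i) u (act (k + l + L + 1 - int i) l v w)"
  have fin: "finite ?I"
    by (rule finite_subset[of _ "{..nat (k + l + L + 1)}"]) auto
  have homogeneous: "act k l (res V L l u v) w = (\<Sum>i\<in>?I. ?T u v i)"
    if u: "u \<in> grading V M" and v: "v \<in> grading V N" for u M v N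
  proof -
    define m n where "m = l + M" and "n = N - L - k - 2"
    have "act k l (res V L l u v) w =
        Sum_any (\<lambda>i::nat. act k l ((of_int m gchoose i) *\<^sub>C modes V u (L + int i) v) w)"
      unfolding res_homogeneous[OF u] m_def
      by (rule is_linear_Sum_any[OF act_linear_left finite_scaled_modes])
    also have "\<dots> = Sum_any (\<lambda>i::nat. (of_int m gchoose i) *\<^sub>C
        Y (modes V u (L + int i) v) (m + n - int i) w)"
      by (simp add: is_linear_scale[OF act_linear_left] act_homogeneous[OF modes_grading[OF u v]]
          m_def n_def algebra_simps)
    also have "\<dots> = Sum_any (\<lambda>i::nat. ((-1) ^ i * (of_int L gchoose i)) *\<^sub>C
        Y u (m + L - int i) (Y v (n + int i) w))"
    proof -
      have "Y u (m + int i) w = 0" for i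
        using Y_degree[OF u w, of "m + int i"] G_neg[of "- int i - 1"] by (simp add: m_def)
      then show ?thesis
        unfolding jacobi_at by (simp add: is_linear_0[OF Y_linear_right])
    qed
    also have "\<dots> = Sum_any (?T u v)"
      by (simp add: act_homogeneous[OF u] act_homogeneous[OF v] m_def n_def algebra_simps)
    also have "\<dots> = (\<Sum>i\<in>?I. ?T u v i)"
      by (rule Sum_any.expand_superset[OF fin]) (auto simp: act_negative[OF w] intro: ccontr)
    finally show ?thesis .
  qed
  have lin_u: "is_linear (\<lambda>u. \<Sum>i\<in>?I. ?T u v i)" for v
    by (intro is_linear_sum_pointwise is_linear_scaleC act_linear_left)
  have lin_v: "is_linear (\<lambda>v. \<Sum>i\<in>?I. ?T u v i)" for u
    by (intro is_linear_sum_pointwise is_linear_scaleC is_linear_comp[OF act_linear_right]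
        act_linear_left)
  have "act k l (res V L l u v) w = (\<Sum>i\<in>?I. ?T u v i)" if u: "u \<in> grading V M" for u M
    by (rule homogeneous_ext[OF is_linear_comp[OF act_linear_left res_linear_right] lin_v])
      (rule homogeneous[OF u])
  then show ?thesis
    by (rule homogeneous_ext[OF is_linear_comp[OF act_linear_left res_linear_left] lin_u])
qed

text \<open>
  The \<open>m\<close>-th residue in \<^const>\<open>diamond_entry\<close> passes through the levels \<open>n - m, n - m - 1, \<dots>, 0\<close>.
  In the sum over \<open>m\<close> all levels but \<open>n\<close> cancel.
\<close>

lemma act_diamond_entry:
  assumes w: "w \<in> G (int l)"
  shows "act (int k) (int l) (diamond_entry V k n l u v) w =
           act (int k) (int n) u (act (int n) (int l) v w)"
proof -
  define q :: int where "q = - int k + int n - int l - 1"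
  define T where "T j = act (int k) (int j) u (act (int j) (int l) v w)" for j
  define c :: "nat \<Rightarrow> nat \<Rightarrow> complex" where
    "c m i = (of_int q gchoose m) * ((-1) ^ i * ((of_int q - of_nat m) gchoose i))" for m i
  have step: "act (int k) (int l)
          (res V (- int k + int n - int l - int m - 1) (int l) u v) w =
      (\<Sum>i\<le>n - m. ((-1) ^ i * ((of_int q - of_nat m) gchoose i)) *\<^sub>C T (n - (m + i)))"
    if "m \<le> n" for m
    unfolding act_res[OF w]
    using that by (intro sum.cong) (auto simp: T_def q_def of_nat_diff algebra_simps)
  have "act (int k) (int l) (diamond_entry V k n l u v) w =
      (\<Sum>m\<le>n. (of_int q gchoose m) *\<^sub>C act (int k) (int l)
         (res V (- int k + int n - int l - int m - 1) (int l) u v) w)"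
    unfolding diamond_entry_def
    by (simp only: is_linear_sum[OF act_linear_left] is_linear_scale[OF act_linear_left] q_def)
  also have "\<dots> = (\<Sum>m\<le>n. \<Sum>i\<le>n - m. c m i *\<^sub>C T (n - (m + i)))"
    by (intro sum.cong refl, subst step) (simp_all add: cv.scale_sum_right c_def)
  also have "\<dots> = (\<Sum>(m, i)\<in>{(m, i). m + i \<le> n}. c m i *\<^sub>C T (n - (m + i)))"
    by (subst sum.Sigma) (auto intro!: sum.cong)
  \<comment> \<open>collect the terms that pass through the same level \<open>n - t\<close>\<close>
  also have "\<dots> = (\<Sum>t\<le>n. (\<Sum>m\<le>t. c m (t - m)) *\<^sub>C T (n - t))"
    by (simp add: sum.triangle_reindex_eq cv.scale_sum_left)
  also have "\<dots> = (\<Sum>t\<le>n. if t = 0 then T n else 0)"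
    by (simp add: c_def gbinomial_cancellation if_distrib[of "\<lambda>r. r *\<^sub>C _"] cong: if_cong)
  finally show ?thesis
    by (simp add: T_def)
qed

lemma act_diamond:
  assumes B: "B \<in> U_inf" and w: "w \<in> G (int l)"
  shows "act (int k) (int l) (diamond V A B k l) w =
           Sum_any (\<lambda>n. act (int k) (int n) (A k n) (act (int n) (int l) (B n l) w))"
proof -
  have "finite {n. diamond_entry V k n l (A k n) (B n l) \<noteq> 0}"
    by (rule finite_subset[of _ "{n. B n l \<noteq> 0}"]) (use B in \<open>auto simp: U_inf_def\<close>)
  then show ?thesis
    unfolding diamond_def
    by (simp add: is_linear_Sum_any[OF act_linear_left] act_diamond_entry[OF w])
qed

definition annihilator :: "'v matrix set" where
  "annihilator = {A \<in> U_inf. \<forall>k l. \<forall>w\<in>G (int l). act (int k) (int l) (A k l) w = 0}"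

lemma two_sided_ideal_annihilator: "two_sided_ideal V annihilator"
  unfolding two_sided_ideal_def
proof (intro conjI ballI)
  show "annihilator \<subseteq> U_inf"
    by (auto simp: annihilator_def)
  show "cv.subspace annihilator"
  proof (rule cv.subspaceI)
    show "0 \<in> annihilator"
      by (simp add: annihilator_def U_inf_def)
    show "A + B \<in> annihilator" if "A \<in> annihilator" "B \<in> annihilator" for A B
    proof -
      have "finite {k. A k l + B k l \<noteq> 0}" for l
        by (rule finite_subset[of _ "{k. A k l \<noteq> 0} \<union> {k. B k l \<noteq> 0}"])
          (use that in \<open>auto simp: annihilator_def U_inf_def\<close>)
      then show ?thesis
        using that by (simp add: annihilator_def U_inf_def is_linear_add[OF act_linear_left])
    qed
    show "c *\<^sub>C A \<in> annihilator" if "A \<in> annihilator" for c A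
    proof -
      have "finite {k. c *\<^sub>C A k l \<noteq> 0}" for l
        by (rule finite_subset[of _ "{k. A k l \<noteq> 0}"])
          (use that in \<open>auto simp: annihilator_def U_inf_def\<close>)
      then show ?thesis
        using that
        by (simp add: annihilator_def U_inf_def scaleC_fun_def is_linear_scale[OF act_linear_left])
    qed
  qed
  fix A B :: "'v matrix"
  assume A: "A \<in> U_inf" and B: "B \<in> annihilator"
  then have BU: "B \<in> U_inf" and B0: "\<And>k l w. w \<in> G (int l) \<Longrightarrow> act (int k) (int l) (B k l) w = 0"
    by (auto simp: annihilator_def)
  show "diamond V A B \<in> annihilator"
    using A by (simp add: annihilator_def U_inf_diamond BU act_diamond B0)
  show "diamond V B A \<in> annihilator"
    using A by (simp add: annihilator_def U_inf_diamond BU act_diamond B0 act_mem)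
qed

text \<open>
  In the residues of the first kind the highest possible intermediate level is \<open>- p - 1 < 0\<close>, so the
  sum in \<open>act_res\<close> is empty. For the second kind, the mode of \<open>L(-1) v\<close> from level \<open>l\<close> to level \<open>k\<close>
  is \<open>- (wt v + l - k)\<close> times that of \<open>v\<close>.
\<close>

lemma O_inf_annihilated: "O_inf V \<subseteq> annihilator"
proof
  fix A
  assume A: "A \<in> O_inf V"
  have generators: "act (int k) (int l) x w = 0"
    if x: "x \<in> O_entry_gens V k l" and w: "w \<in> G (int l)" for x k l w
    using x unfolding O_entry_gens_def
  proof (elim UnE CollectE exE conjE)
    fix u v p
    assume "x = res V (- int k - int l - int p - 2) (int l) u v"
    then show ?thesis
      by (simp add: act_res[OF w])
  next
    fix v
    assume x: "x = Lm1 V v + L0 V v + of_int (int l - int k) *\<^sub>C v"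
    have L0: "is_linear (L0 V)"
      unfolding L0_def
      by (rule is_linear_componentwise)
        (rule is_linearI; simp add: scaleC_add_right cv.scale_left_commute)
    have Lm1: "is_linear (Lm1 V)"
      unfolding Lm1_def by (rule modes_linear_left)
    have id: "is_linear (\<lambda>v. v)"
      by (simp add: linear_on_def)
    have "act (int k) (int l) (Lm1 V v + L0 V v + of_int (int l - int k) *\<^sub>C v) w = 0"
    proof (rule homogeneous_ext[OF _ is_linear_zero, where
          f = "\<lambda>v. act (int k) (int l) (Lm1 V v + L0 V v + of_int (int l - int k) *\<^sub>C v) w"])
      show "is_linear (\<lambda>v. act (int k) (int l) (Lm1 V v + L0 V v + of_int (int l - int k) *\<^sub>C v) w)"
        by (intro is_linear_comp[OF act_linear_left] is_linear_plus Lm1 L0 is_linear_scaleC id)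
      fix N v
      assume v: "v \<in> grading V N"
      have "Lm1 V v \<in> grading V (N + 1)"
        using modes_grading[OF v vacuum_grading, of "-2"] by (simp add: Lm1_def add.commute)
      then have "act (int k) (int l) (Lm1 V v) w =
          of_int (- (N + int l - int k)) *\<^sub>C Y v (N + int l - int k - 1) w"
        by (simp add: act_homogeneous Y_Lm1 algebra_simps)
      then have "act (int k) (int l) (Lm1 V v + L0 V v + of_int (int l - int k) *\<^sub>C v) w =
          (of_int (- (N + int l - int k)) + of_int N + of_int (int l - int k)) *\<^sub>C
            Y v (N + int l - int k - 1) w"
        by (simp only: L0_homogeneous[OF v] is_linear_add[OF act_linear_left]
            is_linear_scale[OF act_linear_left] act_homogeneous[OF v] cv.scale_left_distrib)
      then show "act (int k) (int l) (Lm1 V v + L0 V v + of_int (int l - int k) *\<^sub>C v) w = 0"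
        by simp
    qed
    then show ?thesis
      by (simp only: x)
  qed
  have "act (int k) (int l) (A k l) w = 0" if w: "w \<in> G (int l)" for k l w
  proof (rule vanishes_on_span[OF act_linear_left])
    show "A k l \<in> cv.span (O_entry_gens V k l)"
      using A by (simp add: O_inf_def)
    show "act (int k) (int l) x w = 0" if "x \<in> O_entry_gens V k l" for x
      using that w by (rule generators)
  qed
  with A show "A \<in> annihilator"
    by (simp add: annihilator_def O_inf_def)
qed


text \<open>
  The Jacobi identity with \<open>l\<close>, \<open>m\<close>, \<open>n\<close> replaced by \<open>p\<close>, \<open>N + n - k - 1\<close>, \<open>wt u + l - n - 1\<close>. These
  modes make all terms go from level \<open>l + p\<close> to level \<open>k\<close>, and the conditions on \<open>j\<close> in the two sums
  discard exactly the terms through a negative level.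
\<close>

lemma commutator_on_levels:
  assumes v: "v \<in> grading V N" and w: "w \<in> G (l + p)"
  shows "Sum_any (\<lambda>j::nat. (of_int (N + n - k - 1) gchoose j) *\<^sub>C
             act k (l + p) (modes V v (p + int j) u) w) =
     (\<Sum>j | n + p - int j \<ge> 0. ((-1) ^ j * (of_int p gchoose j)) *\<^sub>C
        act k (n + p - int j) v (act (n + p - int j) (l + p) u w)) -
     (\<Sum>j | l - n + k + p - int j \<ge> 0. ((-1) powi (p - int j) * (of_int p gchoose j)) *\<^sub>C
        act k (l - n + k + p - int j) u (act (l - n + k + p - int j) (l + p) v w))"
    (is "?lhs u = ?sum1 u - ?sum2 u")
proof (rule homogeneous_ext[of ?lhs "\<lambda>u. ?sum1 u - ?sum2 u"])
  have "finite {j. (of_int (N + n - k - 1) gchoose j) *\<^sub>C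
      act k (l + p) (modes V v (p + int j) u) w \<noteq> 0}" for u
    by (rule finite_subset[OF _ finite_modes[of v p u]]) auto
  then show "is_linear ?lhs"
    by (intro is_linear_Sum_any_pointwise is_linear_scaleC
        is_linear_comp[OF act_linear_left modes_linear_right])
  show "is_linear (\<lambda>u. ?sum1 u - ?sum2 u)"
    by (intro is_linear_minus is_linear_sum_pointwise is_linear_scaleC
        is_linear_comp[OF act_linear_right] act_linear_left)
  fix M u
  assume u: "u \<in> grading V M"
  have fin: "finite {j. c - int j \<ge> 0}" for c
    by (rule finite_subset[of _ "{..nat c}"]) auto
  define m r where "m = N + n - k - 1" and "r = M + l - n - 1"
  have "?lhs u = Sum_any (\<lambda>j::nat. (of_int m gchoose j) *\<^sub>C
      Y (modes V v (p + int j) u) (m + r - int j) w)"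
    by (simp add: act_homogeneous[OF modes_grading[OF v u]] m_def r_def algebra_simps)
  also have "\<dots> =
      Sum_any (\<lambda>j::nat. ((-1) ^ j * (of_int p gchoose j)) *\<^sub>C
         Y v (m + p - int j) (Y u (r + int j) w)) -
      Sum_any (\<lambda>j::nat. ((-1) powi (p + int j) * (of_int p gchoose j)) *\<^sub>C
         Y u (r + p - int j) (Y v (m + int j) w))"
    by (rule jacobi_at)
  also have "Sum_any (\<lambda>j::nat. ((-1) ^ j * (of_int p gchoose j)) *\<^sub>C
         Y v (m + p - int j) (Y u (r + int j) w)) =
      Sum_any (\<lambda>j::nat. ((-1) ^ j * (of_int p gchoose j)) *\<^sub>C
         act k (n + p - int j) v (act (n + p - int j) (l + p) u w))"
    by (simp add: act_homogeneous[OF u] act_homogeneous[OF v] m_def r_def algebra_simps)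
  also have "\<dots> = ?sum1 u"
    by (rule Sum_any.expand_superset[OF fin]) (auto simp: act_negative[OF w] intro: ccontr)
  also have "Sum_any (\<lambda>j::nat. ((-1) powi (p + int j) * (of_int p gchoose j)) *\<^sub>C
         Y u (r + p - int j) (Y v (m + int j) w)) =
      Sum_any (\<lambda>j::nat. ((-1) powi (p - int j) * (of_int p gchoose j)) *\<^sub>C
         act k (l - n + k + p - int j) u (act (l - n + k + p - int j) (l + p) v w))"
  proof -
    have "(-1) powi (p + int j) = ((-1) powi (p - int j) :: complex)" for j
      by (simp add: power_int_minus_left)
    then show ?thesis
      by (simp add: act_homogeneous[OF u] act_homogeneous[OF v] m_def r_def algebra_simps)
  qed
  also have "\<dots> = ?sum2 u"
    by (rule Sum_any.expand_superset[OF fin]) (auto simp: act_negative[OF w] intro: ccontr)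
  finally show "?lhs u = ?sum1 u - ?sum2 u" .
qed

lemma J_inf_annihilated: "J_inf V \<subseteq> annihilator"
  unfolding J_inf_def
proof (rule cv.span_minimal)
  show "cv.subspace annihilator"
    using two_sided_ideal_annihilator by (simp add: two_sided_ideal_def)
  have "J_gen V k l p n N u v \<in> annihilator"
    if lp: "l + p \<ge> 0" and v: "v \<in> grading V N" for k l p n N u v
  proof -
    let ?E = "elem_matrix k (nat (l + p))"
    have E: "is_linear ?E"
      by (rule is_linearI) (auto simp: elem_matrix_def scaleC_fun_def fun_eq_iff)
    have inj: "inj ?E"
      by (rule injI) (metis elem_matrix_def)
    \<comment> \<open>all summands of the generator are supported at the single entry \<open>(k, l + p)\<close>\<close>
    have E_diamond: "diamond V (elem_matrix k i x) (elem_matrix i (nat (l + p)) y) =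
        ?E (diamond_entry V k i (nat (l + p)) x y)" for i x y
    proof (intro ext)
      fix a b
      have "(\<lambda>r. diamond_entry V a r b (elem_matrix k i x a r) (elem_matrix i (nat (l + p)) y r b)) =
          (\<lambda>r. if r = i then ?E (diamond_entry V k i (nat (l + p)) x y) a b else 0)"
        by (auto simp: elem_matrix_def)
      then show "diamond V (elem_matrix k i x) (elem_matrix i (nat (l + p)) y) a b =
          ?E (diamond_entry V k i (nat (l + p)) x y) a b"
        unfolding diamond_def by (simp only: Sum_any.delta)
    qed
    define X where "X =
     (\<Sum>j | n + p - int j \<ge> 0. ((-1) ^ j * (of_int p gchoose j)) *\<^sub>C
        diamond_entry V k (nat (n + p - int j)) (nat (l + p)) v u) -
     (\<Sum>j | l - n + int k + p - int j \<ge> 0. ((-1) powi (p - int j) * (of_int p gchoose j)) *\<^sub>C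
        diamond_entry V k (nat (l - n + int k + p - int j)) (nat (l + p)) u v) -
     Sum_any (\<lambda>j::nat. (of_int (N + n - int k - 1) gchoose j) *\<^sub>C modes V v (p + int j) u)"
    have J: "J_gen V k l p n N u v = ?E X"
      unfolding J_gen_def X_def E_diamond
      by (simp only: is_linear_diff[OF E] is_linear_sum[OF E] is_linear_scale[OF E]
          is_linear_Sum_any[OF E finite_scaled_modes])
    have "act (int k) (l + p) X w = 0" if w: "w \<in> G (l + p)" for w
    proof -
      have w': "w \<in> G (int (nat (l + p)))"
        using w lp by simp
      have "act (int k) (l + p) (Sum_any (\<lambda>j::nat. (of_int (N + n - int k - 1) gchoose j) *\<^sub>C
            modes V v (p + int j) u)) w =
          Sum_any (\<lambda>j::nat. (of_int (N + n - int k - 1) gchoose j) *\<^sub>C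
            act (int k) (l + p) (modes V v (p + int j) u) w)"
        by (simp add: is_linear_Sum_any[OF act_linear_left finite_scaled_modes]
            is_linear_scale[OF act_linear_left])
      moreover have "act (int k) (l + p) (diamond_entry V k (nat i) (nat (l + p)) x y) w =
          act (int k) i x (act i (l + p) y w)" if "i \<ge> 0" for i x y
        using act_diamond_entry[OF w', of k "nat i" x y] lp that by simp
      ultimately show ?thesis
        using commutator_on_levels[OF v w, of n "int k" u] unfolding X_def
        by (simp add: is_linear_diff[OF act_linear_left] is_linear_sum[OF act_linear_left]
            is_linear_scale[OF act_linear_left])
    qed
    moreover have "?E X \<in> U_inf"
      unfolding U_inf_def elem_matrix_def by (auto intro: finite_subset[of _ "{k}"])
    ultimately show ?thesis
      using lp by (simp add: J annihilator_def elem_matrix_def)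
  qed
  then show "{J_gen V k l p n N u v | k l p n N u v. l + p \<ge> 0 \<and> v \<in> grading V N} \<subseteq> annihilator"
    by blast
qed

theorem generated_ideal_annihilated: "generated_ideal V (O_inf V \<union> J_inf V) \<subseteq> annihilator"
  unfolding generated_ideal_def
  using two_sided_ideal_annihilator O_inf_annihilated J_inf_annihilated by blast

end


section \<open>The Fock space\<close>

text \<open>
  The Fock space is a quotient, so an explicit representation of the Heisenberg algebra is needed to
  see that its vacuum is not zero. A function on occupation numbers \<open>e\<close> is regarded as the family of
  coefficients of the monomials \<open>\<Prod>\<^sub>i x\<^sub>i\<^bsup>e i\<^esup>\<close>. Then \<open>\<alpha>(-i)\<close> is multiplication by \<open>x\<^sub>i\<close> and \<open>\<alpha>(i)\<close> is \<open>i\<close>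
  times the partial derivative with respect to \<open>x\<^sub>i\<close>, for \<open>i > 0\<close>, and \<open>\<alpha>(0) = 0\<close>. Both act
  coefficientwise, so arbitrary families of coefficients, not only finite ones, can be allowed.
\<close>

type_synonym occupation = "nat \<Rightarrow> nat"

fun fock_op :: "heis \<Rightarrow> (occupation \<Rightarrow> complex) \<Rightarrow> occupation \<Rightarrow> complex" where
  "fock_op (Alpha m) f e =
     (if m < 0 then (if e (nat (- m)) = 0 then 0 else f (e(nat (- m) := e (nat (- m)) - 1)))
      else of_int m * of_nat (e (nat m) + 1) * f (e(nat m := e (nat m) + 1)))"
| "fock_op Central f e = f e"

definition word_op :: "heis list \<Rightarrow> (occupation \<Rightarrow> complex) \<Rightarrow> occupation \<Rightarrow> complex" where
  "word_op u = foldr fock_op u"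

lemma fock_op_linear: "is_linear (fock_op h)"
  by (cases h; rule is_linearI)
    (auto simp: fun_eq_iff scaleC_fun_def scaleC_complex_def algebra_simps)

lemma word_op_linear: "is_linear (word_op u)"
proof (induction u)
  case Nil
  show ?case by (simp add: linear_on_def word_op_def)
next
  case (Cons h u)
  then show ?case
    using is_linear_comp[OF fock_op_linear, of "word_op u" h] by (simp add: word_op_def comp_def)
qed

lemma word_op_append: "word_op (u @ u') f = word_op u (word_op u' f)"
  by (simp add: word_op_def)

lemma fock_op_bracket:
  "fock_op h (fock_op g f) = fock_op g (fock_op h f) + bracket_coeff h g *\<^sub>C f"
proof (cases h; cases g)
  fix m n
  assume h: "h = Alpha m" and g: "g = Alpha n"
  consider "m < 0" "n < 0" | "m < 0" "n = - m" | "m < 0" "n \<ge> 0" "n \<noteq> - m"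
    | "m \<ge> 0" "n < 0" "n \<noteq> - m" | "m > 0" "n = - m" | "m \<ge> 0" "n \<ge> 0"
    by linarith
  then show ?thesis
  proof cases
    case 1
    then show ?thesis
      by (cases "m = n") (auto simp: h g fun_eq_iff scaleC_fun_def fun_upd_twist nat_eq_iff)
  next
    case 2
    then show ?thesis
      by (auto simp: h g fun_eq_iff scaleC_fun_def scaleC_complex_def of_nat_diff algebra_simps)
  next
    case 3
    then have "nat (- m) \<noteq> nat n"
      by auto
    with 3 show ?thesis
      by (auto simp: h g fun_eq_iff scaleC_fun_def fun_upd_twist)
  next
    case 4
    then have "nat (- n) \<noteq> nat m"
      by auto
    with 4 show ?thesis
      by (auto simp: h g fun_eq_iff scaleC_fun_def fun_upd_twist)
  next
    case 5
    then show ?thesis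
      by (auto simp: h g fun_eq_iff scaleC_fun_def scaleC_complex_def of_nat_diff algebra_simps)
  next
    case 6
    then show ?thesis
      by (cases "m = n") (auto simp: h g fun_eq_iff scaleC_fun_def fun_upd_twist nat_eq_iff)
  qed
qed (auto simp: fun_eq_iff scaleC_fun_def)

text \<open>
  The vacuum expectation value, read off from the representation on monomials, vanishes on the
  relations and takes the value 1 on the empty word.
\<close>

lemma fock_vacuum_nonzero: "fock_vacuum \<noteq> 0"
proof -
  define f0 :: "occupation \<Rightarrow> complex" where "f0 e = (if e = (\<lambda>_. 0) then 1 else 0)" for e
  \<comment> \<open>\<open>f0\<close> represents the constant polynomial 1, and \<open>c u\<close> is the constant term of \<open>u\<close> applied to it\<close>
  define c where "c u = word_op u f0 (\<lambda>_. 0)" for u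
  define \<phi> :: "(heis list \<Rightarrow>\<^sub>0 complex) \<Rightarrow> complex" where
    "\<phi> x = Sum_any (\<lambda>u. c u *\<^sub>C Poly_Mapping.lookup x u)" for x
  have "is_linear (\<lambda>x. c u *\<^sub>C Poly_Mapping.lookup x u)" for u
    by (intro is_linear_scaleC is_linearI)
      (simp_all add: lookup_add scaleC_poly_mapping.rep_eq)
  moreover have "finite {u. c u *\<^sub>C Poly_Mapping.lookup x u \<noteq> 0}" for x
    by (rule finite_subset[OF _ finite_lookup[of x]]) (auto simp: scaleC_complex_def)
  ultimately have lin: "is_linear \<phi>"
    unfolding \<phi>_def by (rule is_linear_Sum_any_pointwise)
  have \<phi>_word: "\<phi> (word u) = c u" for u
  proof -
    have "(\<lambda>x. c x *\<^sub>C Poly_Mapping.lookup (word u) x) = (\<lambda>x. if x = u then c u else 0)"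
      by (auto simp: lookup_single scaleC_complex_def when_def)
    then show ?thesis
      unfolding \<phi>_def by (simp only: Sum_any.delta)
  qed
  have "\<phi> x = 0" if "x \<in> fock_relations" for x
  proof (rule vanishes_on_span[OF lin _ that[unfolded fock_relations_def]])
    fix x
    assume "x \<in> {word (u @ [h, g] @ w) - word (u @ [g, h] @ w)
        - bracket_coeff h g *\<^sub>C word (u @ [Central] @ w) | u h g w. True} \<union>
      {word (u @ [Alpha m]) | u m. m \<ge> 0} \<union> {word (u @ [Central]) - word u | u. True}"
    then show "\<phi> x = 0"
    proof (elim UnE CollectE exE conjE)
      fix u h g w
      assume x: "x = word (u @ [h, g] @ w) - word (u @ [g, h] @ w)
        - bracket_coeff h g *\<^sub>C word (u @ [Central] @ w)"
      have Central: "word_op [Central] f = f" for f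
        by (simp add: word_op_def fun_eq_iff)
      have "word_op [h, g] f = word_op [g, h] f + bracket_coeff h g *\<^sub>C f" for f
        using fock_op_bracket[of h g f] by (simp add: word_op_def)
      then show "\<phi> x = 0"
        unfolding x is_linear_diff[OF lin] is_linear_scale[OF lin] \<phi>_word c_def word_op_append Central
        by (simp add: is_linear_add[OF word_op_linear] is_linear_scale[OF word_op_linear])
          (simp add: scaleC_fun_def)
    next
      fix u and m :: int
      assume x: "x = word (u @ [Alpha m])" and m: "m \<ge> 0"
      have "word_op [Alpha m] f0 = 0"
        using m by (auto simp: word_op_def fun_eq_iff f0_def)
      then show "\<phi> x = 0"
        by (simp add: x \<phi>_word c_def word_op_append is_linear_0[OF word_op_linear])
    next
      fix u
      assume x: "x = word (u @ [Central]) - word u"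
      have "word_op [Central] f0 = f0"
        by (simp add: word_op_def fun_eq_iff)
      then show "\<phi> x = 0"
        by (simp add: x is_linear_diff[OF lin] \<phi>_word c_def word_op_append)
    qed
  qed
  moreover have "\<phi> (word []) = 1"
    by (simp add: \<phi>_word c_def word_op_def f0_def)
  ultimately have "word [] \<notin> fock_relations"
    by force
  then show ?thesis
    unfolding fock_vacuum_def zero_fock_def by (simp add: fock.abs_eq_iff)
qed

lemma alpha_alpha_vacuum:
  "alpha m (alpha n fock_vacuum) =
     alpha n (alpha m fock_vacuum) + (if m + n = 0 then of_int m else 0) *\<^sub>C fock_vacuum"
proof transfer
  fix m n :: int
  let ?c = "if m + n = 0 then of_int m else 0 :: complex"
  have "word ([] @ [Alpha m, Alpha n] @ []) - word ([] @ [Alpha n, Alpha m] @ [])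
      - bracket_coeff (Alpha m) (Alpha n) *\<^sub>C word ([] @ [Central] @ []) \<in> fock_relations"
    unfolding fock_relations_def by (rule cv.span_base) blast
  moreover have "word ([] @ [Central]) - word [] \<in> fock_relations"
    unfolding fock_relations_def by (rule cv.span_base) blast
  ultimately have "(word [Alpha m, Alpha n] - word [Alpha n, Alpha m] - ?c *\<^sub>C word [Central]) +
      ?c *\<^sub>C (word [Central] - word []) \<in> fock_relations"
    by (intro cv.subspace_add cv.subspace_scale subspace_fock_relations) simp_all
  then show "prepend (Alpha m) (prepend (Alpha n) (word [])) -
      (prepend (Alpha n) (prepend (Alpha m) (word [])) + ?c *\<^sub>C word []) \<in> fock_relations"
    by (simp add: cv.scale_right_diff_distrib algebra_simps)
qed

lemma fock_grading_negative:
  assumes "n < 0"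
  shows "fock_grading n = {0}"
proof -
  have "sum_list is \<ge> 0" if "\<forall>i\<in>set is. i > 0" for "is" :: "int list"
    by (rule sum_list_nonneg) (use that in force)
  with assms have "{foldr (\<lambda>i. alpha (- i)) is fock_vacuum | is.
      (\<forall>i\<in>set is. i > 0) \<and> sum_list is = n} = {}"
    by fastforce
  then show ?thesis
    by (simp only: fock_grading_def cv.span_empty)
qed

lemma fock_monomial_grading:
  assumes "\<forall>i\<in>set is. i > 0" "sum_list is = n"
  shows "foldr (\<lambda>i. alpha (- i)) is fock_vacuum \<in> fock_grading n"
  unfolding fock_grading_def using assms by (intro cv.span_base) blast


section \<open>An element that acts as zero on all associated graded spaces\<close>

text \<open>
  In the Fock module of charge \<open>x\<close> the zero mode of this vector is the same scalar on a whole level,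
  independent of \<open>x\<close>: it is \<open>-2\<close> on level 0 and 0 on level 1. The middle summand is there to
  cancel \<open>\<alpha>(0)\<^sup>2 = x\<^sup>2\<close>.
\<close>

definition level_detector :: fock where
  "level_detector = alpha (-1) (alpha (-1) fock_vacuum) - alpha (-2) (alpha (-2) fock_vacuum)
     - 2 *\<^sub>C fock_vacuum"

context lower_bounded_generalized_module
begin

lemma mmodes_linear: "w \<in> mspace W \<Longrightarrow> is_linear (\<lambda>v. mmodes W v n w)"
  using mmodes_linear_left by (simp add: linear_on_def)

lemma mode_kl_linear: "w \<in> mspace W \<Longrightarrow> is_linear (\<lambda>v. mode_kl V W k l v w)"
  unfolding mode_kl_def by (intro is_linear_componentwise mmodes_linear)

lemma mode_kl_homogeneous:
  assumes "w \<in> mspace W" "v \<in> grading V N"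
  shows "mode_kl V W k l v w = mmodes W v (N + int l - int k - 1) w"
  unfolding mode_kl_def
  by (rule componentwise_homogeneous[OF _ assms(2)]) (rule is_linear_0[OF mmodes_linear[OF assms(1)]])

text \<open>The case \<open>m = 0\<close> of the Jacobi identity.\<close>

lemma mmodes_iterate:
  assumes "w \<in> mspace W"
  shows "mmodes W (modes V a l b) n w =
     Sum_any (\<lambda>i::nat. ((-1) ^ i * (of_int l gchoose i)) *\<^sub>C
                mmodes W a (l - int i) (mmodes W b (n + int i) w)) -
     Sum_any (\<lambda>i::nat. ((-1) powi (l + int i) * (of_int l gchoose i)) *\<^sub>C
                mmodes W b (n + l - int i) (mmodes W a (int i) w))"
proof -
  have "Sum_any (\<lambda>i::nat. (of_int 0 gchoose i) *\<^sub>C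
          mmodes W (modes V a (l + int i) b) (0 + n - int i) w) =
     Sum_any (\<lambda>i::nat. ((-1) ^ i * (of_int l gchoose i)) *\<^sub>C
                mmodes W a (0 + l - int i) (mmodes W b (n + int i) w)) -
     Sum_any (\<lambda>i::nat. ((-1) powi (l + int i) * (of_int l gchoose i)) *\<^sub>C
                mmodes W b (n + l - int i) (mmodes W a (0 + int i) w))"
    using m_jacobi assms unfolding jacobi_identity_def by blast
  then show ?thesis
    by (simp add: Sum_any_gbinomial_0[of "\<lambda>_. 1", simplified])
qed

text \<open>The case \<open>l = 0\<close> of the Jacobi identity.\<close>

lemma mmodes_commutator:
  assumes "w \<in> mspace W"
  shows "mmodes W a m (mmodes W b n w) - mmodes W b n (mmodes W a m w) =
     Sum_any (\<lambda>i::nat. (of_int m gchoose i) *\<^sub>C mmodes W (modes V a (int i) b) (m + n - int i) w)"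
proof -
  have "Sum_any (\<lambda>i::nat. (of_int m gchoose i) *\<^sub>C
          mmodes W (modes V a (0 + int i) b) (m + n - int i) w) =
     Sum_any (\<lambda>i::nat. ((-1) ^ i * (of_int 0 gchoose i)) *\<^sub>C
                mmodes W a (m + 0 - int i) (mmodes W b (n + int i) w)) -
     Sum_any (\<lambda>i::nat. ((-1) powi (0 + int i) * (of_int 0 gchoose i)) *\<^sub>C
                mmodes W b (n + 0 - int i) (mmodes W a (m + int i) w))"
    using m_jacobi assms unfolding jacobi_identity_def by blast
  then show ?thesis
    by (simp add: Sum_any_gbinomial_0)
qed

end

context heisenberg_voa
begin

lemma monomial_grading:
  "(\<forall>i\<in>set is. i > 0) \<Longrightarrow> sum_list is = n \<Longrightarrow>
     foldr (\<lambda>i. alpha (- i)) is fock_vacuum \<in> grading M n"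
  unfolding grading_eq by (rule fock_monomial_grading)

lemma monomials_grading:
  "fock_vacuum \<in> grading M 0" "alpha (-1) fock_vacuum \<in> grading M 1"
  "alpha (-1) (alpha (-1) fock_vacuum) \<in> grading M 2"
  "alpha (-2) (alpha (-2) fock_vacuum) \<in> grading M 4"
  using monomial_grading[of "[]" 0] monomial_grading[of "[1]" 1]
    monomial_grading[of "[1, 1]" 2] monomial_grading[of "[2, 2]" 4] by simp_all

lemma Lm1_alpha: "Lm1 M (alpha (-1) fock_vacuum) = alpha (-2) fock_vacuum"
  by (simp add: Lm1_def modes_alpha vacuum_eq)

lemma alpha_nonneg_alpha:
  "alpha (int i) (alpha (-1) fock_vacuum) = (if i = 1 then fock_vacuum else 0)"
proof -
  have "alpha (int i) fock_vacuum = 0"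
    using creation(1)[of "int i" "alpha (-1) fock_vacuum"] by (simp add: modes_alpha vacuum_eq)
  moreover have "alpha m 0 = 0" for m
    using is_linear_0[OF modes_linear_right, of "alpha (-1) fock_vacuum" m] by (simp add: modes_alpha)
  ultimately show ?thesis
    by (simp add: alpha_alpha_vacuum[of "int i"] scaleC_one)
qed

end

locale heisenberg_module = heisenberg_voa M + lower_bounded_generalized_module M W
  for M :: "fock vertex_algebra_data" and W :: "(fock, 'w::complex_vector) module_data"
begin

abbreviation a :: "int \<Rightarrow> 'w \<Rightarrow> 'w" where
  "a \<equiv> mmodes W (alpha (-1) fock_vacuum)"

lemma alpha_commutator:
  assumes w: "w \<in> mspace W"
  shows "a m (a n w) = a n (a m w) + (if m + n = 0 then of_int m else 0) *\<^sub>C w"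
proof -
  have "a m (a n w) - a n (a m w) = Sum_any (\<lambda>i::nat. (of_int m gchoose i) *\<^sub>C
      mmodes W (if i = 1 then fock_vacuum else 0) (m + n - int i) w)"
    unfolding mmodes_commutator[OF w] modes_alpha alpha_nonneg_alpha ..
  also have "(\<lambda>i::nat. (of_int m gchoose i) *\<^sub>C
        mmodes W (if i = 1 then fock_vacuum else 0) (m + n - int i) w) =
      (\<lambda>i. if i = 1 then of_int m *\<^sub>C mmodes W fock_vacuum (m + n - 1) w else 0)"
    by (auto simp: fun_eq_iff is_linear_0[OF mmodes_linear[OF w]])
  also have "Sum_any \<dots> = of_int m *\<^sub>C mmodes W fock_vacuum (m + n - 1) w"
    by (rule Sum_any.delta)
  also have "\<dots> = (if m + n = 0 then of_int m else 0) *\<^sub>C w"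
    using m_vacuum[OF w] by (simp add: vacuum_eq)
  finally show ?thesis
    by (simp add: algebra_simps)
qed

text \<open>
  The modes of \<open>\<alpha>(-i) b\<close> are sums of products \<open>\<alpha>(-i-j) b\<^sub>r\<close> and \<open>b\<^sub>r \<alpha>(j)\<close> with \<open>j \<ge> 0\<close>. If the total
  degree is negative, then so is the degree of \<open>b\<^sub>r\<close> in the products of the first kind, and in those
  of the second kind for \<open>j = 0\<close>; there induction applies because \<open>\<alpha>(0)\<close> commutes with all \<open>\<alpha>(m)\<close>.
\<close>

lemma monomial_negative_degree:
  assumes "\<forall>i\<in>set is. i > 0" "y \<in> mspace W" "\<And>m. m \<ge> 1 \<Longrightarrow> a m y = 0" "sum_list is - k - 1 < 0"
  shows "mmodes W (foldr (\<lambda>i. alpha (- i)) is fock_vacuum) k y = 0"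
  using assms
proof (induction "is" arbitrary: y k)
  case Nil
  then show ?case
    using m_vacuum[of y k] by (simp add: vacuum_eq)
next
  case (Cons i "is")
  let ?b = "foldr (\<lambda>i. alpha (- i)) is fock_vacuum"
  have i: "i > 0" and pos: "\<forall>i\<in>set is. i > 0"
    using Cons.prems by auto
  have zero: "a 0 y \<in> mspace W" "\<And>m. m \<ge> 1 \<Longrightarrow> a m (a 0 y) = 0"
    using Cons.prems by (simp_all add: mmodes_mem mmodes_0 alpha_commutator[of y _ 0])
  have "mmodes W ?b (k + int j) y = 0" for j
    by (rule Cons.IH[OF pos]) (use Cons.prems i in auto)
  moreover have "mmodes W ?b (k + - i - int j) (a (int j) y) = 0" for j
  proof (cases "j = 0")
    case True
    have "mmodes W ?b (k + - i) (a 0 y) = 0"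
      by (rule Cons.IH[OF pos zero]) (use Cons.prems in auto)
    then show ?thesis using True by simp
  qed (simp add: Cons.prems mmodes_0)
  ultimately have "mmodes W (modes M (alpha (-1) fock_vacuum) (- i) ?b) k y = 0"
    unfolding mmodes_iterate[OF Cons.prems(2)] by (simp add: mmodes_0)
  then show ?case
    by (simp add: modes_alpha)
qed

lemma Omega_0_iff: "y \<in> Omega M W 0 \<longleftrightarrow> y \<in> mspace W \<and> (\<forall>m\<ge>1. a m y = 0)"
proof
  assume "y \<in> Omega M W 0"
  then show "y \<in> mspace W \<and> (\<forall>m\<ge>1. a m y = 0)"
    using monomials_grading(2) by (auto simp: Omega_def)
next
  assume y: "y \<in> mspace W \<and> (\<forall>m\<ge>1. a m y = 0)"
  have "mmodes W v k y = 0" if v: "v \<in> grading M N" and k: "N - k - 1 < 0" for N v k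
  proof (rule vanishes_on_span[OF mmodes_linear])
    show "v \<in> cv.span {foldr (\<lambda>i. alpha (- i)) is fock_vacuum | is.
        (\<forall>i\<in>set is. i > 0) \<and> sum_list is = N}"
      using v by (simp add: grading_eq fock_grading_def)
  qed (use y k monomial_negative_degree in auto)
  with y show "y \<in> Omega M W 0"
    by (auto simp: Omega_def)
qed

text \<open>
  On \<open>\<Omega>\<^sub>1(W)\<close> all \<open>\<alpha>(m)\<close> with \<open>m \<ge> 2\<close> vanish, so that at most the terms with \<open>i = 0, 1\<close> of each sum in
  \<open>mmodes_iterate\<close> survive. For \<open>\<alpha>(-2)\<^sup>2 1\<close> the term with \<open>i = 1\<close> vanishes as well, since the mode of index 0
  of a derivative is zero.
\<close>

lemma level_detector_mode:
  assumes w: "w \<in> Omega M W 1"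
  shows "mode_kl M W 1 1 level_detector w = 2 *\<^sub>C (a (-1) (a 1 w) - w)"
proof -
  have wW: "w \<in> mspace W"
    using w by (rule Omega_mspace)
  have a0: "a m w = 0" if "m \<ge> 2" for m
    using w that monomials_grading(2) by (auto simp: Omega_def)
  have "mmodes W (modes M (alpha (-1) fock_vacuum) (-1) (alpha (-1) fock_vacuum)) 1 w =
      a (-1) (a 1 w) - (- a 0 (a 0 w) - a (-1) (a 1 w))"
    unfolding mmodes_iterate[OF wW]
    by (subst (1 2) Sum_any_two) (simp_all add: a0 mmodes_0 scaleC_one)
  then have quadratic: "mmodes W (alpha (-1) (alpha (-1) fock_vacuum)) 1 w =
      a 0 (a 0 w) + 2 *\<^sub>C a (-1) (a 1 w)"
    using scaleC_add_left[of 1 1 "a (-1) (a 1 w)"] by (simp add: modes_alpha scaleC_one)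
  have derivative: "mmodes W (alpha (-2) fock_vacuum) n y = of_int (- n) *\<^sub>C a (n - 1) y"
    if "y \<in> mspace W" for n y
    using m_Lm1 that by (auto simp flip: Lm1_alpha)
  have "mmodes W (modes M (alpha (-1) fock_vacuum) (-2) (alpha (-2) fock_vacuum)) 3 w =
      a 0 (a 0 w)"
    unfolding mmodes_iterate[OF wW]
    by (subst (1 2) Sum_any_two)
      (simp_all add: a0 mmodes_0 scaleC_one derivative wW mmodes_mem)
  then have "mmodes W (alpha (-2) (alpha (-2) fock_vacuum)) 3 w = a 0 (a 0 w)"
    by (simp add: modes_alpha)
  moreover have "mmodes W fock_vacuum (-1) w = w"
    using m_vacuum[OF wW] by (simp add: vacuum_eq)
  ultimately show ?thesis
    unfolding level_detector_def
    by (simp add: quadratic is_linear_diff[OF mode_kl_linear[OF wW]]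
        is_linear_scale[OF mode_kl_linear[OF wW]] cv.scale_right_diff_distrib
        mode_kl_homogeneous[OF wW] monomials_grading[THEN mode_kl_homogeneous[OF wW]])
qed

text \<open>
  For \<open>w \<in> \<Omega>\<^sub>1(W)\<close> the vector \<open>\<alpha>(1) w\<close> is killed by all \<open>\<alpha>(m)\<close> with \<open>m \<ge> 1\<close>, so \<open>\<alpha>(-1) \<alpha>(1) w\<close> and \<open>w\<close> have
  the same image \<open>\<alpha>(1) w\<close> under \<open>\<alpha>(1)\<close>, and their difference lies in \<open>\<Omega>\<^sub>0(W)\<close>.
\<close>

lemma level_detector_theta_kernel: "elem_matrix 1 1 level_detector \<in> theta_kernel M W"
proof -
  have "mode_kl M W 1 1 level_detector w \<in> Omega M W 0" if w: "w \<in> Omega M W 1" for w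
  proof -
    have wW: "w \<in> mspace W"
      using w by (rule Omega_mspace)
    have "a 1 w \<in> Omega M W 0"
      by (rule mmodes_Omega[OF w monomials_grading(2)]) simp
    then have 1: "a 1 w \<in> mspace W" "\<And>m. m \<ge> 1 \<Longrightarrow> a m (a 1 w) = 0"
      by (auto simp: Omega_0_iff)
    have "a m (a (-1) (a 1 w) - w) = 0" if m: "m \<ge> 1" for m
    proof -
      have "a m w = (if m = 1 then a 1 w else 0)"
        using w m monomials_grading(2) by (auto simp: Omega_def)
      moreover have "a m (a (-1) (a 1 w)) = (if m = 1 then a 1 w else 0)"
        using 1(2)[OF m] by (simp add: alpha_commutator[OF 1(1), of m] mmodes_0 scaleC_one)
      moreover have "a m (a (-1) (a 1 w) - w) = a m (a (-1) (a 1 w)) - a m w"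
        using linear_onD(2)[OF mmodes_linear_right, of "a (-1) (a 1 w) - w" w] wW 1(1)
        by (simp add: cv.subspace_diff[OF subspace_mspace] mmodes_mem algebra_simps)
      ultimately show ?thesis by simp
    qed
    then have "a (-1) (a 1 w) - w \<in> Omega M W 0"
      using wW 1(1) by (simp add: Omega_0_iff cv.subspace_diff[OF subspace_mspace] mmodes_mem)
    then show ?thesis
      unfolding level_detector_mode[OF w] by (rule cv.subspace_scale[OF subspace_Omega])
  qed
  moreover have "mode_kl M W k l 0 w = 0" if "w \<in> Omega M W (int l)" for k l w
    by (rule is_linear_0[OF mode_kl_linear[OF Omega_mspace[OF that]]])
  moreover have "elem_matrix 1 1 level_detector \<in> U_inf"
    by (auto simp: U_inf_def elem_matrix_def intro: finite_subset[of _ "{1}"])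
  ultimately show ?thesis
    unfolding theta_kernel_iff by (auto simp: elem_matrix_def cv.subspace_0[OF subspace_Omega])
qed

end


section \<open>The level_detector lies outside the generated ideal\<close>

context heisenberg_voa
begin

text \<open>The shift puts the vacuum into level 1; level 0 has weight \<open>-1\<close> and is therefore zero.\<close>

lemma nat_graded_adjoint_shift: "nat_graded_module M (modes M) (\<lambda>n. grading M (n - 1))"
proof
  fix v :: fock and n N j l :: int and w
  show "is_linear (\<lambda>v. modes M v n w)" "is_linear (modes M v n)"
    by (rule modes_linear_left modes_linear_right)+
  show "jacobi_identity M UNIV (modes M)"
    by (rule jacobi)
  show "modes M (Lm1 M v) n w = of_int (- n) *\<^sub>C modes M v (n - 1) w"
    by (rule Lm1_derivative)
  show "cv.subspace (grading M (n - 1))"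
    by (rule subspace_grading)
  show "n < 0 \<Longrightarrow> grading M (n - 1) = {0}"
    by (simp add: grading_eq fock_grading_negative)
  show "modes M v j w \<in> grading M (l + N - j - 1 - 1)"
    if "v \<in> grading M N" "w \<in> grading M (l - 1)"
    using modes_grading[OF that, of j] by (simp add: algebra_simps)
qed

sublocale shifted: nat_graded_module M "modes M" "\<lambda>n. grading M (n - 1)"
  by (rule nat_graded_adjoint_shift)

text \<open>
  By the creation property the two quadratic summands, acting by modes of positive index, kill the
  vacuum; only the multiple of the vacuum in \<^const>\<open>level_detector\<close> contributes.
\<close>

lemma level_detector_not_annihilated: "elem_matrix 1 1 level_detector \<notin> shifted.annihilator"
proof
  assume "elem_matrix 1 1 level_detector \<in> shifted.annihilator"
  then have "shifted.act 1 1 level_detector fock_vacuum = 0"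
    using monomials_grading(1)
    by (force simp: shifted.annihilator_def elem_matrix_def dest: spec[of _ 1])
  moreover have "shifted.act 1 1 level_detector fock_vacuum = - (2 *\<^sub>C fock_vacuum)"
    unfolding level_detector_def
    using creation(1)[of 1] creation(1)[of 3] vacuum_left[of "-1" fock_vacuum]
    by (simp add: is_linear_diff[OF shifted.act_linear_left]
        is_linear_scale[OF shifted.act_linear_left]
        monomials_grading[THEN shifted.act_homogeneous] vacuum_eq)
  ultimately show False
    using fock_vacuum_nonzero by simp
qed

end

theorem corollary8:
  fixes M1 :: "fock vertex_algebra_data"
  assumes "heisenberg_voa M1"
  shows "\<exists>A. A \<in> Q_inf M1 \<and> A \<notin> generated_ideal M1 (O_inf M1 \<union> J_inf M1)"
proof (intro exI conjI)
  interpret heisenberg_voa M1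
    by (rule assms)
  show "elem_matrix 1 1 level_detector \<in> Q_inf M1"
  proof -
    have "elem_matrix 1 1 level_detector \<in> theta_kernel M1 W"
      if "lower_bounded_generalized_module M1 W" for W :: "(fock, nat \<Rightarrow> complex) module_data"
      by (rule heisenberg_module.level_detector_theta_kernel, rule heisenberg_module.intro[OF assms that])
    then show ?thesis
      unfolding Q_inf_def by blast
  qed
  show "elem_matrix 1 1 level_detector \<notin> generated_ideal M1 (O_inf M1 \<union> J_inf M1)"
    using level_detector_not_annihilated shifted.generated_ideal_annihilated by blast
qed

end
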